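(* Let $n\ge 1$, let $1=\ell_1<\ell_2<\cdots<\ell_n$ be reals, let $q_1,\dots,q_n>0$ with $\sum_{i=1}^n q_i=1$, and put $\overline{\ell}=\sum_{i=1}^n q_i\ell_i$. Consider the multidisperse process $\mathcal{M}((\ell_1,q_1),\dots,(\ell_n,q_n))$ with type $k$ saturation numbers $N_{k,L}$, and fix $k\in\{1,\dots,n\}$. Define $P_{i;k}:(0,\infty)\to\mathbb{R}$ by $$P_{i;k}(s)=\int_{\ell_n-\ell_i}^{\ell_n}\mathbb{E}[N_{k,L}]\,e^{-sL}\,dL \qquad (1\le i\le n),$$ and $G_k:(0,\infty)\to\mathbb{R}$ by $$G_k(s)=e^{-(\ell_n-\overline{\ell})s}\Big(q_k+s(\ell_n-\overline{\ell})\,\mathbb{E}[N_{k,\ell_n}]\Big)+2s\,e^{\overline{\ell}s}\sum_{i=1}^n q_i e^{-\ell_i s}P_{i;k}(s).$$ Then $$\lim_{L\to\infty}\frac{\mathbb{E}[N_{k,L}]}{L}=\int_0^\infty G_k(t)\exp\Big(-2\sum_{i=1}^n q_i\,\mathrm{Ein}(\ell_i t)\Big)\,dt .$$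
   Context: $\mathrm{Ein}(z)=\int_0^z\frac{1-e^{-t}}{t}\,dt$. Multidisperse process $\mathcal{M}((\ell_1,q_1),\dots,(\ell_n,q_n))$ on $[0,L]$: start with $I_0=[0,L]$ (empty region) and $P_0=\emptyset$ (set of parked segments). At each time $T=1,2,\dots$, independently of the past, sample $b$ uniformly from $[0,L]$ and, independently, a type $i\in\{1,\dots,n\}$ with probability $q_i$. If $(b,b+\ell_i)\subseteq I_{T-1}$, set $I_T=I_{T-1}\setminus(b,b+\ell_i)$ and $P_T=P_{T-1}\cup\{(b,b+\ell_i)\}$ (the segment is parked); otherwise $I_T=I_{T-1}$, $P_T=P_{T-1}$. The type $k$ saturation number is $N_{k,L}=\lim_{T\to\infty}|\{A\in P_T:\lambda(A)=\ell_k\}|$, where $\lambda$ is Lebesgue measure. *)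

theory Defs
  imports "HOL-Probability.Probability"
begin

definition Ein :: "real \<Rightarrow> real" where
  "Ein z = (LBINT t=0..z. (1 - exp (- t)) / t)"

text \<open>
  The segment lengths \<open>len 1, \<dots>, len n\<close> and type probabilities \<open>q 1, \<dots>, q n\<close> are
  given by functions on \<open>nat\<close>, of which only the values on \<open>{1..n}\<close> are relevant.
  The law below is a probability measure only for \<open>L > 0\<close>; for \<open>L = 0\<close> it is junk, which
  is harmless because \<open>L\<close> is afterwards either integrated over or sent to infinity.
\<close>

definition sample_law :: "nat \<Rightarrow> (nat \<Rightarrow> real) \<Rightarrow> real \<Rightarrow> (real \<times> nat) measure" where
  "sample_law n q L =
     uniform_measure lborel {0..L} \<Otimes>\<^sub>M point_measure {1..n} (\<lambda>i. ennreal (q i))"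

text \<open>The pair \<open>(I\<^sub>T, P\<^sub>T)\<close>; the sample drawn at time \<open>T = 1, 2, \<dots>\<close> is \<open>\<omega> !! (T - 1)\<close>.\<close>

primrec parking_state ::
    "(nat \<Rightarrow> real) \<Rightarrow> real \<Rightarrow> (real \<times> nat) stream \<Rightarrow> nat \<Rightarrow> real set \<times> real set set" where
  "parking_state len L \<omega> 0 = ({0..L}, {})"
| "parking_state len L \<omega> (Suc T) =
     (let (I, P) = parking_state len L \<omega> T;
          (b, i) = \<omega> !! T;
          A = {b<..<b + len i}
      in if A \<subseteq> I then (I - A, insert A P) else (I, P))"

definition saturation_number ::
    "(nat \<Rightarrow> real) \<Rightarrow> nat \<Rightarrow> real \<Rightarrow> (real \<times> nat) stream \<Rightarrow> real" where
  "saturation_number len k L \<omega> =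
     lim (\<lambda>T. real (card {A \<in> snd (parking_state len L \<omega> T). measure lborel A = len k}))"

definition expected_saturation ::
    "nat \<Rightarrow> (nat \<Rightarrow> real) \<Rightarrow> (nat \<Rightarrow> real) \<Rightarrow> nat \<Rightarrow> real \<Rightarrow> real" where
  "expected_saturation n len q k L =
     (LINT \<omega>|stream_space (sample_law n q L). saturation_number len k L \<omega>)"

definition mean_length :: "nat \<Rightarrow> (nat \<Rightarrow> real) \<Rightarrow> (nat \<Rightarrow> real) \<Rightarrow> real" where
  "mean_length n len q = (\<Sum>i=1..n. q i * len i)"

definition P_fun ::
    "nat \<Rightarrow> (nat \<Rightarrow> real) \<Rightarrow> (nat \<Rightarrow> real) \<Rightarrow> nat \<Rightarrow> nat \<Rightarrow> real \<Rightarrow> real" where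
  "P_fun n len q i k s =
     (LBINT L:{len n - len i..len n}. expected_saturation n len q k L * exp (- s * L))"

definition G_fun ::
    "nat \<Rightarrow> (nat \<Rightarrow> real) \<Rightarrow> (nat \<Rightarrow> real) \<Rightarrow> nat \<Rightarrow> real \<Rightarrow> real" where
  "G_fun n len q k s =
     exp (- (len n - mean_length n len q) * s) *
       (q k + s * (len n - mean_length n len q) * expected_saturation n len q k (len n))
     + 2 * s * exp (mean_length n len q * s) *
       (\<Sum>i=1..n. q i * exp (- len i * s) * P_fun n len q i k s)"

end

(*
  Conditioning on the first sample (parked or not) gives a recursion for the expected number of
  type k segments parked in [a, c] by time T. The two sides of a parked segment are filled by the
  same stream of samples, so by linearity of expectation their dependence is irrelevant. Letting T
  tend to infinity yields, with f(x) = E[N_{k,x}] and l the mean length,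
    (x - l) f(x) = q_k (x - l_k) + 2 sum_i q_i int_0^{x - l_i} f      for x >= l_n.

  For S(x) = int_0^x f this implies x f(x) - 2 S(x) = O(x), so (S(x) / x^2)' = O(1 / x^2) and
  f(x) / x has a limit C. By an Abelian argument s^2 F(s) tends to C as s -> 0+, where F is the
  Laplace transform of f restricted to [l_n, oo). The recursion turns into a linear first-order
  equation for F, which states that
    s^2 exp (l s - 2 sum_i q_i Ein(l_i s)) F(s)
  has derivative - G_k(s) exp (- 2 sum_i q_i Ein(l_i s)). It vanishes at infinity and tends to C
  at 0, which identifies C with the integral.
*)
theory Submission
  imports Defs
begin

section \<open>Parking counts along a fixed stream of samples\<close>

text \<open>The pieces left beside a parked segment keep being hit by samples from the whole window
  [0, L], not from windows of their own length. The recursion therefore relates counts in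
  subintervals under one fixed law, whereas E[N_{k,x}] for different x belongs to different laws.
  Two facts repair this. Inside the window the expected count depends only on the length of the
  interval, because the density of b is constant. And the factor 1/L multiplies only the increment
  from T to T + 1, which vanishes in the limit, so the limiting equation no longer mentions L.

  Below l_n some types do not fit and the equation is truncated; its coefficient is x - l only from
  l_n on. Cutting the transform at l_n creates the boundary data in G_k: the stretch between l_n -
  l_i and l_n gives P_{i;k}, and what lies below it collapses, by the recursion at l_n itself, into
  the term with E[N_{k,l_n}].

  Since the density is shown to exist before any transform appears, the Abelian direction suffices
  and no Tauberian condition arises. Integrability of the final integrand comes from G_k being
  nonnegative.\<close>

definition park_step ::
    "(nat \<Rightarrow> real) \<Rightarrow> real \<times> nat \<Rightarrow> real set \<times> real set set \<Rightarrow> real set \<times> real set set" where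
  "park_step len x S =
     (let A = {fst x<..<fst x + len (snd x)}
      in if A \<subseteq> fst S then (fst S - A, insert A (snd S)) else S)"

text \<open>Reads the stream from its head and starts from an arbitrary state, whereas
  \<open>parking_state\<close> peels off the latest sample. Conditioning on the first sample needs
  this orientation.\<close>

primrec park_run ::
    "(nat \<Rightarrow> real) \<Rightarrow> nat \<Rightarrow> real set \<times> real set set \<Rightarrow> (real \<times> nat) stream
      \<Rightarrow> real set \<times> real set set" where
  "park_run len 0 S \<omega> = S"
| "park_run len (Suc T) S \<omega> = park_run len T (park_step len (shd \<omega>) S) (stl \<omega>)"

text \<open>Only the free region influences later parking, so the set of parked segments shrinks to
  a counter. Types are compared by index instead of length; injectivity of \<open>len\<close> on the
  types makes the two agree.\<close>

primrec parked_count ::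
    "(nat \<Rightarrow> real) \<Rightarrow> nat \<Rightarrow> nat \<Rightarrow> real set \<Rightarrow> (real \<times> nat) stream \<Rightarrow> nat" where
  "parked_count len k 0 I \<omega> = 0"
| "parked_count len k (Suc T) I \<omega> =
     (let A = {fst (shd \<omega>)<..<fst (shd \<omega>) + len (snd (shd \<omega>))}
      in if A \<subseteq> I
         then of_bool (snd (shd \<omega>) = k) + parked_count len k T (I - A) (stl \<omega>)
         else parked_count len k T I (stl \<omega>))"

lemma park_run_Suc_last:
  "park_run len (Suc T) S \<omega> = park_step len (\<omega> !! T) (park_run len T S \<omega>)"
proof (induction T arbitrary: S \<omega>)
  case 0
  show ?case by simp
next
  case (Suc T)
  show ?case using Suc.IH[of "park_step len (shd \<omega>) S" "stl \<omega>"] by simp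
qed

lemma parking_state_eq_park_run: "parking_state len L \<omega> T = park_run len T ({0..L}, {}) \<omega>"
proof (induction T)
  case (Suc T)
  then show ?case
    unfolding park_run_Suc_last
    by (auto simp: park_step_def Let_def split: prod.splits)
qed simp

text \<open>Parked segments stay disjoint from the free region. A newly parked segment is nonempty
  and free, hence not yet in the set, so each insertion really raises the cardinality.\<close>

lemma card_park_run:
  assumes "finite P" "\<And>A. A \<in> P \<Longrightarrow> A \<inter> I = {}"
    and "\<omega> \<in> streams (UNIV \<times> J)" "\<And>i. i \<in> J \<Longrightarrow> 0 < len i" "inj_on len J" "k \<in> J"
  shows "card {A \<in> snd (park_run len T (I, P) \<omega>). measure lborel A = len k} =
         card {A \<in> P. measure lborel A = len k} + parked_count len k T I \<omega>"
  using assms(1-3)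
proof (induction T arbitrary: I P \<omega>)
  case (Suc T)
  obtain b i \<omega>' where \<omega>: "\<omega> = (b, i) ## \<omega>'"
    by (metis stream.collapse surj_pair)
  have i: "i \<in> J" and \<omega>': "\<omega>' \<in> streams (UNIV \<times> J)"
    using Suc.prems(3) by (auto simp: \<omega> streams_Stream)
  have pos: "0 < len i" using assms(4) i by blast
  define A where "A = {b<..<b + len i}"
  show ?case
  proof (cases "A \<subseteq> I")
    case True
    \<comment> \<open>The midpoint shows that \<open>A\<close> is nonempty; a member of
      \<open>P\<close> contained in \<open>I\<close> would have to be empty.\<close>
    have "b + len i / 2 \<in> A" using pos by (auto simp: A_def)
    then have new: "A \<notin> P" using Suc.prems(2) True by blast
    have mA: "measure lborel A = len k \<longleftrightarrow> i = k"
      using pos inj_onD[OF assms(5) _ i assms(6)] by (auto simp: A_def)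
    have fin: "finite {A \<in> P. measure lborel A = len k}" using Suc.prems(1) by simp
    have "{B \<in> insert A P. measure lborel B = len k} =
        (if i = k then insert A {B \<in> P. measure lborel B = len k}
         else {B \<in> P. measure lborel B = len k})"
      using mA by auto
    then have c: "card {B \<in> insert A P. measure lborel B = len k} =
        of_bool (i = k) + card {B \<in> P. measure lborel B = len k}"
      using new fin by simp
    have "card {B \<in> snd (park_run len T (I - A, insert A P) \<omega>'). measure lborel B = len k} =
        card {B \<in> insert A P. measure lborel B = len k} + parked_count len k T (I - A) \<omega>'"
      using Suc.prems True by (intro Suc.IH \<omega>') auto
    then show ?thesis
      using True c by (simp add: \<omega> park_step_def A_def[symmetric])
  next
    case False
    then show ?thesis
      using Suc.IH[OF Suc.prems(1,2) \<omega>'] by (simp add: \<omega> park_step_def A_def[symmetric])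
  qed
qed simp

text \<open>Chosen because it is inherited by subsets of both regions, hence is preserved when
  parked segments are removed, and because it says exactly that no sample can straddle the two
  regions.\<close>

definition interval_separated :: "real set \<Rightarrow> real set \<Rightarrow> bool" where
  "interval_separated I J \<longleftrightarrow>
     I \<inter> J = {} \<and> (\<forall>a b. {a<..<b} \<subseteq> I \<union> J \<longrightarrow> {a<..<b} \<subseteq> I \<or> {a<..<b} \<subseteq> J)"

text \<open>An interval inside \<open>I\<close> has no point in \<open>J'\<close>, since
  \<open>J' \<subseteq> J\<close> is disjoint from \<open>I\<close>; so if it is covered by
  \<open>I' \<union> J'\<close> it lies in \<open>I'\<close>. The other side is symmetric.\<close>

lemma interval_separated_subset:
  assumes "interval_separated I J" "I' \<subseteq> I" "J' \<subseteq> J"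
  shows "interval_separated I' J'"
  unfolding interval_separated_def
proof (intro conjI allI impI)
  show "I' \<inter> J' = {}" using assms by (auto simp: interval_separated_def)
  fix a b :: real
  assume s: "{a<..<b} \<subseteq> I' \<union> J'"
  then have "{a<..<b} \<subseteq> I \<or> {a<..<b} \<subseteq> J"
    using assms unfolding interval_separated_def by (meson Un_mono order_trans)
  then show "{a<..<b} \<subseteq> I' \<or> {a<..<b} \<subseteq> J'"
    using s assms unfolding interval_separated_def by blast
qed

lemma interval_separated_Icc:
  assumes "b < (c::real)"
  shows "interval_separated {a..b} {c..d}"
  unfolding interval_separated_def
proof (intro conjI allI impI)
  show "{a..b} \<inter> {c..d} = {}" using assms by auto
  fix x y :: real
  assume s: "{x<..<y} \<subseteq> {a..b} \<union> {c..d}"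
  show "{x<..<y} \<subseteq> {a..b} \<or> {x<..<y} \<subseteq> {c..d}"
  proof (rule ccontr)
    assume "\<not> ?thesis"
    then obtain u v where "u \<in> {x<..<y}" "u \<notin> {a..b}" "v \<in> {x<..<y}" "v \<notin> {c..d}" by blast
    moreover from this s have "u \<in> {c..d}" "v \<in> {a..b}" by blast+
    \<comment> \<open>An open interval with points on both sides contains the midpoint of the gap,
      which neither side covers.\<close>
    ultimately have "(b + c) / 2 \<in> {x<..<y}" "(b + c) / 2 \<notin> {a..b} \<union> {c..d}"
      using assms by auto
    then show False using s by blast
  qed
qed

text \<open>Additivity holds for each fixed stream, so no independence between the two sides of a parked
  segment is ever needed.\<close>

lemma parked_count_Un:
  assumes "interval_separated I J" "\<omega> \<in> streams (UNIV \<times> K)" "\<forall>i\<in>K. 0 < len i"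
  shows "parked_count len k T (I \<union> J) \<omega> = parked_count len k T I \<omega> + parked_count len k T J \<omega>"
  using assms(1,2)
proof (induction T arbitrary: I J \<omega>)
  case (Suc T)
  obtain b i \<omega>' where \<omega>: "\<omega> = (b, i) ## \<omega>'"
    by (metis stream.collapse surj_pair)
  have i: "i \<in> K" and \<omega>': "\<omega>' \<in> streams (UNIV \<times> K)"
    using Suc.prems(2) by (auto simp: \<omega> streams_Stream)
  have pos: "0 < len i" using assms(3) i by blast
  define A where "A = {b<..<b + len i}"
  have ne: "A \<noteq> {}" using pos by (auto simp: A_def)
  have dis: "I \<inter> J = {}" using Suc.prems by (auto simp: interval_separated_def)
  have IH: "parked_count len k T (I' \<union> J') \<omega>' = parked_count len k T I' \<omega>' + parked_count len k T J' \<omega>'"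
    if "I' \<subseteq> I" "J' \<subseteq> J" for I' J'
    using Suc.IH[OF interval_separated_subset[OF Suc.prems(1) that] \<omega>'] .
  \<comment> \<open>Separation decides where the sample can park. As \<open>A\<close> is nonempty
    and the regions are disjoint, it changes at most one of the two counts.\<close>
  consider "A \<subseteq> I" | "A \<subseteq> J" | "\<not> A \<subseteq> I \<union> J"
    using Suc.prems(1) unfolding interval_separated_def A_def by blast
  then show ?case
  proof cases
    case 1
    then have "A \<subseteq> I \<union> J" "\<not> A \<subseteq> J" "I \<union> J - A = (I - A) \<union> J" using ne dis by blast+
    then show ?thesis using 1 IH[of "I - A" J] by (simp add: \<omega> A_def[symmetric])
  next
    case 2
    then have "A \<subseteq> I \<union> J" "\<not> A \<subseteq> I" "I \<union> J - A = I \<union> (J - A)" using ne dis by blast+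
    then show ?thesis using 2 IH[of I "J - A"] by (simp add: \<omega> A_def[symmetric])
  next
    case 3
    then have "\<not> A \<subseteq> I" "\<not> A \<subseteq> J" by blast+
    then show ?thesis using 3 IH[of I J] by (simp add: \<omega> A_def[symmetric])
  qed
qed simp

text \<open>Parked segments are open, so removing one from a closed interval leaves two closed
  intervals, separated by the positive length of the segment. Closed intervals are thus the only
  regions that the analysis has to follow.\<close>

lemma parked_count_Suc_Icc:
  assumes "\<omega> \<in> streams (UNIV \<times> K)" "\<forall>i\<in>K. 0 < len i" "i \<in> K"
  shows "parked_count len k (Suc T) {a..c} ((b, i) ## \<omega>) =
    (if a \<le> b \<and> b + len i \<le> c
     then of_bool (i = k) + parked_count len k T {a..b} \<omega> + parked_count len k T {b + len i..c} \<omega>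
     else parked_count len k T {a..c} \<omega>)"
proof -
  have pos: "0 < len i" using assms by blast
  have sub: "{b<..<b + len i} \<subseteq> {a..c} \<longleftrightarrow> a \<le> b \<and> b + len i \<le> c"
    using pos by (subst greaterThanLessThan_subseteq_atLeastAtMost_iff) simp
  show ?thesis
  proof (cases "a \<le> b \<and> b + len i \<le> c")
    case True
    then have "{a..c} - {b<..<b + len i} = {a..b} \<union> {b + len i..c}" using pos by auto
    moreover have "interval_separated {a..b} {b + len i..c}"
      using pos by (intro interval_separated_Icc) simp
    ultimately show ?thesis
      using parked_count_Un[OF _ assms(1,2)] True sub by simp
  next
    case False
    then have "\<not> {b<..<b + len i} \<subseteq> {a..c}" using sub by blast
    with False show ?thesis by auto
  qed
qed

text \<open>Each parked segment uses up length at least 1 and adds at most 1 to the count. The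
  \<open>max 0\<close> covers empty intervals.\<close>

lemma parked_count_le:
  assumes "\<omega> \<in> streams (UNIV \<times> K)" "\<forall>i\<in>K. 1 \<le> len i"
  shows "real (parked_count len k T {a..c} \<omega>) \<le> max 0 (c - a)"
  using assms(1)
proof (induction T arbitrary: a c \<omega>)
  case (Suc T)
  obtain b i \<omega>' where \<omega>: "\<omega> = (b, i) ## \<omega>'"
    by (metis stream.collapse surj_pair)
  have i: "i \<in> K" and \<omega>': "\<omega>' \<in> streams (UNIV \<times> K)"
    using Suc.prems by (auto simp: \<omega> streams_Stream)
  have pos: "\<forall>i\<in>K. 0 < len i" using assms(2) by force
  show ?case
    using Suc.IH[OF \<omega>', of a b] Suc.IH[OF \<omega>', of "b + len i" c] Suc.IH[OF \<omega>', of a c] assms(2)[rule_format, OF i]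
    unfolding \<omega> parked_count_Suc_Icc[OF \<omega>' pos i]
    by (auto simp del: parked_count.simps split: if_splits)
qed simp

lemma parked_count_mono:
  "mono (\<lambda>T. parked_count len k T I \<omega>)"
proof (rule mono_iff_le_Suc[THEN iffD2], rule)
  fix T show "parked_count len k T I \<omega> \<le> parked_count len k (Suc T) I \<omega>"
  proof (induction T arbitrary: I \<omega>)
    case (Suc T)
    then show ?case
      by (subst (2) parked_count.simps(2), subst parked_count.simps(2)) (auto simp: Let_def simp del: parked_count.simps)
  qed simp
qed

section \<open>The recursion for the expected saturation number\<close>

text \<open>Boundedness makes every inner integral finite, so the unfolding of the first sample
  passes from nonnegative to Bochner integrals.\<close>

lemma (in prob_space) integral_stream_space:
  fixes f :: "'a stream \<Rightarrow> real"
  assumes f[measurable]: "f \<in> borel_measurable (stream_space M)"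
    and bnd: "\<And>\<omega>. \<omega> \<in> space (stream_space M) \<Longrightarrow> 0 \<le> f \<omega> \<and> f \<omega> \<le> B"
  shows "(\<integral>\<omega>. f \<omega> \<partial>stream_space M) = (\<integral>x. (\<integral>\<omega>. f (x ## \<omega>) \<partial>stream_space M) \<partial>M)"
proof -
  interpret S: prob_space "stream_space M" by (rule prob_space_stream_space)
  have bnd': "0 \<le> f (x ## \<omega>) \<and> f (x ## \<omega>) \<le> B"
    if "x \<in> space M" "\<omega> \<in> space (stream_space M)" for x \<omega>
    using bnd[of "x ## \<omega>"] that by (simp add: space_stream_space streams_Stream)
  have inner: "(\<integral>\<^sup>+\<omega>. f (x ## \<omega>) \<partial>stream_space M) = ennreal (\<integral>\<omega>. f (x ## \<omega>) \<partial>stream_space M)"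
    if [measurable]: "x \<in> space M" for x
  proof (rule nn_integral_eq_integral)
    show "integrable (stream_space M) (\<lambda>\<omega>. f (x ## \<omega>))"
      using bnd'[OF that] by (intro S.integrable_const_bound[where B = B]) auto
    show "AE \<omega> in stream_space M. 0 \<le> f (x ## \<omega>)" using bnd'[OF that] by auto
  qed
  have "(\<integral>\<omega>. f \<omega> \<partial>stream_space M) = enn2real (\<integral>\<^sup>+\<omega>. f \<omega> \<partial>stream_space M)"
    using bnd by (intro integral_eq_nn_integral) auto
  also have "(\<integral>\<^sup>+\<omega>. f \<omega> \<partial>stream_space M) = (\<integral>\<^sup>+x. (\<integral>\<^sup>+\<omega>. f (x ## \<omega>) \<partial>stream_space M) \<partial>M)"
    by (rule nn_integral_stream_space) measurable
  also have "\<dots> = (\<integral>\<^sup>+x. ennreal (\<integral>\<omega>. f (x ## \<omega>) \<partial>stream_space M) \<partial>M)"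
    by (intro nn_integral_cong inner)
  also have "enn2real \<dots> = (\<integral>x. (\<integral>\<omega>. f (x ## \<omega>) \<partial>stream_space M) \<partial>M)"
    using bnd' by (intro integral_eq_nn_integral[symmetric] AE_I2 integral_nonneg_AE) auto
  finally show ?thesis .
qed

lemma set_lebesgue_integral_shift:
  fixes g :: "real \<Rightarrow> real"
  shows "(LBINT b:{a..c}. g (b - a)) = (LBINT b:{0..c - a}. g b)"
proof -
  have "(LBINT b:{0..c - a}. g b) = (\<integral>b. indicator {0..c - a} (- a + b) * g (- a + b) \<partial>lborel)"
    unfolding set_lebesgue_integral_def by (subst lborel_integral_real_affine[of 1 _ "- a"]) auto
  also have "\<dots> = (LBINT b:{a..c}. g (b - a))"
    unfolding set_lebesgue_integral_def by (intro Bochner_Integration.integral_cong) (auto simp: indicator_def)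
  finally show ?thesis by simp
qed

lemma set_lebesgue_integral_reflect:
  fixes g :: "real \<Rightarrow> real"
  shows "(LBINT b:{0..y}. g (y - b)) = (LBINT b:{0..y}. g b)"
proof -
  have "(LBINT b:{0..y}. g b) = (\<integral>b. indicator {0..y} (y + - b) * g (y + - b) \<partial>lborel)"
    unfolding set_lebesgue_integral_def by (subst lborel_integral_real_affine[of "-1" _ y]) auto
  also have "\<dots> = (LBINT b:{0..y}. g (y - b))"
    unfolding set_lebesgue_integral_def by (intro Bochner_Integration.integral_cong) (auto simp: indicator_def)
  finally show ?thesis by simp
qed

lemma set_integrable_bounded_Icc:
  fixes f :: "real \<Rightarrow> real"
  assumes "f \<in> borel_measurable borel" "\<And>x. x \<in> {a..b} \<Longrightarrow> \<bar>f x\<bar> \<le> B"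
  shows "set_integrable lborel {a..b} f"
  unfolding set_integrable_def
proof (rule Bochner_Integration.integrable_bound[of _ "\<lambda>x. B * indicator {a..b} x"])
  show "integrable lborel (\<lambda>x. B * indicator {a..b} x :: real)"
    by (intro integrable_mult_right integrable_real_indicator) (auto simp: emeasure_lborel_Icc_eq)
  show "(\<lambda>x. indicat_real {a..b} x *\<^sub>R f x) \<in> borel_measurable lborel" using assms by simp
  show "AE x in lborel. norm (indicat_real {a..b} x *\<^sub>R f x) \<le> norm (B * indicator {a..b} x :: real)"
    using assms(2) by (intro AE_I2) (force simp: indicator_def)
qed

section \<open>The sampling law and its integrals\<close>

locale multidisperse =
  fixes n k :: nat and len q :: "nat \<Rightarrow> real"
  assumes n_pos: "n \<ge> 1"
    and len_1: "len 1 = 1"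
    and len_strict_mono: "strict_mono_on {1..n} len"
    and q_pos: "\<And>i. i \<in> {1..n} \<Longrightarrow> q i > 0"
    and sum_q: "(\<Sum>i=1..n. q i) = 1"
    and k_in: "k \<in> {1..n}"
begin

lemma len_mono: "i \<in> {1..n} \<Longrightarrow> j \<in> {1..n} \<Longrightarrow> i \<le> j \<Longrightarrow> len i \<le> len j"
  using len_strict_mono by (metis strict_mono_on_leD)

lemma len_ge_1: "i \<in> {1..n} \<Longrightarrow> 1 \<le> len i"
  using len_mono[of 1 i] len_1 by auto

lemma len_le_len_n: "i \<in> {1..n} \<Longrightarrow> len i \<le> len n"
  using len_mono[of i n] by auto

lemma space_sample_law: "space (sample_law n q L) = UNIV \<times> {1..n}"
  by (simp add: sample_law_def space_pair_measure space_point_measure)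

lemma prob_space_types: "prob_space (point_measure {1..n} (\<lambda>i. ennreal (q i)))"
proof
  have "(\<Sum>i=1..n. ennreal (q i)) = ennreal (\<Sum>i=1..n. q i)"
    using q_pos by (intro sum_ennreal) (simp add: less_imp_le)
  then show "emeasure (point_measure {1..n} (\<lambda>i. ennreal (q i)))
      (space (point_measure {1..n} (\<lambda>i. ennreal (q i)))) = 1"
    by (simp add: space_point_measure emeasure_point_measure_finite sum_q del: One_nat_def)
qed

lemma prob_space_uniform_Icc: "L > 0 \<Longrightarrow> prob_space (uniform_measure lborel {0..L::real})"
  by (intro prob_space_uniform_measure) auto

lemma prob_space_sample_law: "L > 0 \<Longrightarrow> prob_space (sample_law n q L)"
  unfolding sample_law_def
  using prob_space_types prob_space_uniform_Icc by (intro prob_space_pair) auto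

lemma measurable_sample_law:
  "fst \<in> borel_measurable (sample_law n q L)"
  "(\<lambda>x. h (snd x)) \<in> measurable (sample_law n q L) (count_space UNIV)"
  "(\<lambda>x. g (snd x) :: real) \<in> borel_measurable (sample_law n q L)"
proof -
  show "fst \<in> borel_measurable (sample_law n q L)"
    unfolding sample_law_def by (rule measurable_fst'') simp
  show "(\<lambda>x. h (snd x)) \<in> measurable (sample_law n q L) (count_space UNIV)"
    unfolding sample_law_def by (rule measurable_compose[OF measurable_snd]) simp
  show "(\<lambda>x. g (snd x) :: real) \<in> borel_measurable (sample_law n q L)"
    unfolding sample_law_def by (rule measurable_compose[OF measurable_snd]) simp
qed

lemma integral_uniform_Icc:
  fixes g :: "real \<Rightarrow> real"
  assumes "L > 0" and [measurable]: "g \<in> borel_measurable borel"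
  shows "(\<integral>x. g x \<partial>uniform_measure lborel {0..L}) = (LBINT x:{0..L}. g x) / L"
proof -
  have e: "(indicator {0..L} x / emeasure lborel {0..L}) = ennreal (indicator {0..L} x / L)" for x :: real
    using \<open>L > 0\<close> by (auto simp: indicator_def divide_ennreal ennreal_1[symmetric] simp del: ennreal_1)
  have "(\<integral>x. g x \<partial>uniform_measure lborel {0..L}) = (\<integral>x. (indicator {0..L} x / L) *\<^sub>R g x \<partial>lborel)"
    unfolding uniform_measure_def e using \<open>L > 0\<close> by (intro integral_density) auto
  also have "\<dots> = (\<integral>x. (indicator {0..L} x *\<^sub>R g x) / L \<partial>lborel)"
    by (intro Bochner_Integration.integral_cong) auto
  also have "\<dots> = (LBINT x:{0..L}. g x) / L"
    unfolding set_lebesgue_integral_def by (rule integral_divide_zero)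
  finally show ?thesis .
qed

lemma integral_sample_law:
  fixes f :: "real \<times> nat \<Rightarrow> real"
  assumes "L > 0" and f[measurable]: "f \<in> borel_measurable (sample_law n q L)"
    and bnd: "\<And>x. x \<in> space (sample_law n q L) \<Longrightarrow> \<bar>f x\<bar> \<le> B"
  shows "(\<integral>x. f x \<partial>sample_law n q L) = (\<Sum>i=1..n. q i * (LBINT b:{0..L}. f (b, i))) / L"
proof -
  let ?U = "uniform_measure lborel {0..L}" and ?V = "point_measure {1..n} (\<lambda>i. ennreal (q i))"
  interpret U: prob_space ?U by (rule prob_space_uniform_Icc) fact
  interpret V: prob_space ?V by (rule prob_space_types)
  interpret UV: pair_prob_space ?U ?V ..
  have int: "integrable (?U \<Otimes>\<^sub>M ?V) f"
    using bnd f unfolding sample_law_def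
    by (intro UV.integrable_const_bound[where B = B]) auto
  have meas: "(\<lambda>b. f (b, i)) \<in> borel_measurable borel" if "i \<in> {1..n}" for i
    using measurable_Pair2'[of i ?V ?U] f that
    unfolding sample_law_def by (auto intro!: measurable_compose[of _ ?U] simp: space_point_measure)
  have "(\<integral>x. f x \<partial>sample_law n q L) = (\<integral>i. (\<integral>b. f (b, i) \<partial>?U) \<partial>?V)"
    unfolding sample_law_def using UV.integral_snd[of "\<lambda>b i. f (b, i)"] int by simp
  also have "\<dots> = (\<Sum>i=1..n. q i * (\<integral>b. f (b, i) \<partial>?U))"
    using q_pos by (subst lebesgue_integral_point_measure_finite) (auto simp: less_imp_le)
  also have "\<dots> = (\<Sum>i=1..n. q i * ((LBINT b:{0..L}. f (b, i)) / L))"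
    using integral_uniform_Icc[OF \<open>L > 0\<close> meas] by (intro sum.cong) auto
  finally show ?thesis by (simp add: sum_divide_distrib)
qed

section \<open>Expected counts in subintervals of a fixed sampling window\<close>

abbreviation "sample_stream L \<equiv> stream_space (sample_law n q L)"

lemma space_sample_stream: "space (sample_stream L) = streams (UNIV \<times> {1..n})"
  by (simp add: space_stream_space space_sample_law)

lemma prob_space_sample_stream: "L > 0 \<Longrightarrow> prob_space (sample_stream L)"
  by (intro prob_space.prob_space_stream_space prob_space_sample_law)

lemma len_pos_ball: "\<forall>i\<in>{1..n}. 0 < len i"
  using len_ge_1 by force

text \<open>Measurability jointly in the end points and the stream is the form that survives the
  induction: after a parked sample the end points of the remaining pieces depend on that sample. It
  also makes the expectations measurable in the end points.\<close>

lemma measurable_parked_count: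
  "(\<lambda>x. real (parked_count len k T {fst (fst x)..snd (fst x)} (snd x)))
     \<in> borel_measurable (((borel :: real measure) \<Otimes>\<^sub>M (borel :: real measure)) \<Otimes>\<^sub>M sample_stream L)"
proof (induction T)
  case (Suc T)
  note measurable_sample_law [measurable]
  let ?N = "((borel :: real measure) \<Otimes>\<^sub>M (borel :: real measure)) \<Otimes>\<^sub>M sample_stream L"
  have IH: "(\<lambda>x. real (parked_count len k T {u x..v x} (w x))) \<in> borel_measurable ?N"
    if [measurable]: "u \<in> borel_measurable ?N" "v \<in> borel_measurable ?N" "w \<in> measurable ?N (sample_stream L)" for u v w
    by (rule measurable_compose[OF _ Suc.IH, of "\<lambda>x. ((u x, v x), w x)", simplified]) measurable
  have [measurable]: "(\<lambda>x. fst (shd (snd x))) \<in> borel_measurable ?N"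
      "(\<lambda>x. len (snd (shd (snd x)))) \<in> borel_measurable ?N"
      "(\<lambda>x. of_bool (snd (shd (snd x)) = k) :: real) \<in> borel_measurable ?N"
    by measurable
  show ?case
  proof (subst measurable_cong)
    fix x assume "x \<in> space ?N"
    then have s: "snd x \<in> streams (UNIV \<times> {1..n})"
      using space_sample_stream by (auto simp: space_pair_measure)
    obtain b i \<omega> where \<omega>: "snd x = (b, i) ## \<omega>"
      by (metis stream.collapse surj_pair)
    have i: "i \<in> {1..n}" and "\<omega> \<in> streams (UNIV \<times> {1..n})"
      using s by (auto simp: \<omega> streams_Stream)
    from parked_count_Suc_Icc[OF this(2) len_pos_ball i]
    show "real (parked_count len k (Suc T) {fst (fst x)..snd (fst x)} (snd x)) =
      (if fst (fst x) \<le> fst (shd (snd x)) \<and> fst (shd (snd x)) + len (snd (shd (snd x))) \<le> snd (fst x)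
       then of_bool (snd (shd (snd x)) = k)
         + real (parked_count len k T {fst (fst x)..fst (shd (snd x))} (stl (snd x)))
         + real (parked_count len k T {fst (shd (snd x)) + len (snd (shd (snd x)))..snd (fst x)} (stl (snd x)))
       else real (parked_count len k T {fst (fst x)..snd (fst x)} (stl (snd x))))"
      by (simp add: \<omega> del: parked_count.simps)
  next
    show "(\<lambda>x. if fst (fst x) \<le> fst (shd (snd x)) \<and> fst (shd (snd x)) + len (snd (shd (snd x))) \<le> snd (fst x)
       then of_bool (snd (shd (snd x)) = k)
         + real (parked_count len k T {fst (fst x)..fst (shd (snd x))} (stl (snd x)))
         + real (parked_count len k T {fst (shd (snd x)) + len (snd (shd (snd x)))..snd (fst x)} (stl (snd x)))
       else real (parked_count len k T {fst (fst x)..snd (fst x)} (stl (snd x)))) \<in> borel_measurable ?N"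
      by (intro measurable_If borel_measurable_add IH) measurable
  qed
qed simp

text \<open>The window \<open>L\<close> of the samples is kept apart from the interval
  \<open>{a..c}\<close> to be filled, since the pieces beside a parked segment inherit the original
  law.\<close>

definition expected_count :: "real \<Rightarrow> nat \<Rightarrow> real \<Rightarrow> real \<Rightarrow> real" where
  "expected_count L T a c = (\<integral>\<omega>. real (parked_count len k T {a..c} \<omega>) \<partial>sample_stream L)"

lemma measurable_parked_count' [measurable]:
  "(\<lambda>\<omega>. real (parked_count len k T {a..c} \<omega>)) \<in> borel_measurable (sample_stream L)"
proof -
  have "(\<lambda>\<omega>. ((a, c), \<omega>)) \<in> measurable (sample_stream L) ((borel \<Otimes>\<^sub>M borel) \<Otimes>\<^sub>M sample_stream L)"
    by (rule measurable_Pair1') (simp add: space_pair_measure)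
  from measurable_compose[OF this measurable_parked_count] show ?thesis
    unfolding fst_conv snd_conv .
qed

lemma len_ge_1_ball: "\<forall>i\<in>{1..n}. 1 \<le> len i"
  using len_ge_1 by blast

lemma parked_count_bound:
  "\<omega> \<in> space (sample_stream L) \<Longrightarrow> real (parked_count len k T {a..c} \<omega>) \<le> max 0 (c - a)"
  unfolding space_sample_stream by (rule parked_count_le[OF _ len_ge_1_ball])

lemma integrable_parked_count:
  assumes "L > 0"
  shows "integrable (sample_stream L) (\<lambda>\<omega>. real (parked_count len k T {a..c} \<omega>))"
proof -
  interpret prob_space "sample_stream L" using assms by (rule prob_space_sample_stream)
  show ?thesis
    using parked_count_bound[of _ L T a c]
    by (intro integrable_const_bound[where B = "max 0 (c - a)"]) auto
qed

lemma expected_count_bounds: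
  assumes "L > 0"
  shows "0 \<le> expected_count L T a c" "expected_count L T a c \<le> max 0 (c - a)"
proof -
  interpret prob_space "sample_stream L" using assms by (rule prob_space_sample_stream)
  show "0 \<le> expected_count L T a c" unfolding expected_count_def by simp
  show "expected_count L T a c \<le> max 0 (c - a)"
    unfolding expected_count_def using integrable_parked_count[OF assms] parked_count_bound
    by (intro integral_le_const) auto
qed

lemma measurable_expected_count:
  assumes "L > 0"
  shows "(\<lambda>p. expected_count L T (fst p) (snd p)) \<in> borel_measurable (borel \<Otimes>\<^sub>M borel)"
proof -
  interpret prob_space "sample_stream L" using assms by (rule prob_space_sample_stream)
  show ?thesis
    unfolding expected_count_def
    by (rule borel_measurable_lebesgue_integral)
      (use measurable_parked_count in \<open>simp only: case_prod_beta'\<close>)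
qed

lemma measurable_expected_count' [measurable (raw)]:
  assumes "L > 0" and [measurable]: "u \<in> borel_measurable M" "v \<in> borel_measurable M"
  shows "(\<lambda>x. expected_count L T (u x) (v x)) \<in> borel_measurable M"
proof -
  have "(\<lambda>x. (u x, v x)) \<in> measurable M (borel \<Otimes>\<^sub>M borel)" by measurable
  from measurable_compose[OF this measurable_expected_count[OF assms(1)]] show ?thesis
    unfolding fst_conv snd_conv .
qed

text \<open>A rejected first sample leaves the interval as it was. Splitting off the value at
  \<open>T\<close> therefore leaves an integrand supported on the samples that park, which is why
  the integral stops at \<open>c - len i\<close>.\<close>

lemma expected_count_Suc:
  assumes "L > 0" "0 \<le> a" "c \<le> L"
  shows "expected_count L (Suc T) a c = expected_count L T a c +
    (\<Sum>i=1..n. q i * (LBINT b:{a..c - len i}. of_bool (i = k) + expected_count L T a b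
       + expected_count L T (b + len i) c - expected_count L T a c)) / L"
proof -
  note measurable_sample_law [measurable]
  interpret P: prob_space "sample_law n q L" using assms by (intro prob_space_sample_law)
  interpret S: prob_space "sample_stream L" using assms by (intro prob_space_sample_stream)
  define e where "e = expected_count L T"
  define f where "f = (\<lambda>x. if a \<le> fst x \<and> fst x + len (snd x) \<le> c
      then of_bool (snd x = k) + e a (fst x) + e (fst x + len (snd x)) c - e a c else 0)"
  have e_meas [measurable (raw)]: "(\<lambda>x. e (u x) (v x)) \<in> borel_measurable M"
    if "u \<in> borel_measurable M" "v \<in> borel_measurable M" for u v and M :: "(real \<times> nat) measure"
    unfolding e_def using assms that by measurable
  have f_meas: "f \<in> borel_measurable (sample_law n q L)"
    unfolding f_def by measurable
  have e_bd: "0 \<le> e x y" "e x y \<le> max 0 (y - x)" for x y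
    unfolding e_def using expected_count_bounds assms by auto
  have f_bd: "\<bar>f x\<bar> \<le> 1 + 4 * max 0 (c - a)" if "x \<in> space (sample_law n q L)" for x
  proof -
    have "1 \<le> len (snd x)" using that len_ge_1 by (auto simp: space_sample_law)
    then show ?thesis
      using e_bd[of a "fst x"] e_bd[of "fst x + len (snd x)" c] e_bd[of a c]
      by (auto simp: f_def)
  qed
  have f_int: "integrable (sample_law n q L) f"
    using f_bd f_meas by (intro P.integrable_const_bound[where B = "1 + 4 * max 0 (c - a)"]) auto
  have "expected_count L (Suc T) a c =
      (\<integral>x. (\<integral>\<omega>. real (parked_count len k (Suc T) {a..c} (x ## \<omega>)) \<partial>sample_stream L) \<partial>sample_law n q L)"
    unfolding expected_count_def
    by (rule P.integral_stream_space[OF measurable_parked_count', where B = "max 0 (c - a)"])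
      (simp only: parked_count_bound of_nat_0_le_iff)
  also have "\<dots> = (\<integral>x. e a c + f x \<partial>sample_law n q L)"
  proof (intro Bochner_Integration.integral_cong refl)
    fix x assume x: "x \<in> space (sample_law n q L)"
    obtain b i where bi: "x = (b, i)" by force
    have i: "i \<in> {1..n}" using x by (auto simp: bi space_sample_law)
    have "(\<integral>\<omega>. real (parked_count len k (Suc T) {a..c} (x ## \<omega>)) \<partial>sample_stream L) =
      (\<integral>\<omega>. (if a \<le> b \<and> b + len i \<le> c
        then of_bool (i = k) + real (parked_count len k T {a..b} \<omega>) + real (parked_count len k T {b + len i..c} \<omega>)
        else real (parked_count len k T {a..c} \<omega>)) \<partial>sample_stream L)"
    proof (intro Bochner_Integration.integral_cong refl)
      fix \<omega> assume "\<omega> \<in> space (sample_stream L)"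
      then have "\<omega> \<in> streams (UNIV \<times> {1..n})" by (simp only: space_sample_stream)
      from parked_count_Suc_Icc[OF this len_pos_ball i, of k T a c b]
      show "real (parked_count len k (Suc T) {a..c} (x ## \<omega>)) =
        (if a \<le> b \<and> b + len i \<le> c
        then of_bool (i = k) + real (parked_count len k T {a..b} \<omega>) + real (parked_count len k T {b + len i..c} \<omega>)
        else real (parked_count len k T {a..c} \<omega>))"
        by (simp add: bi del: parked_count.simps)
    qed
    also have "\<dots> = e a c + f x"
    proof (cases "a \<le> b \<and> b + len i \<le> c")
      case True
      then show ?thesis
        using integrable_parked_count[OF assms(1)]
        by (simp add: f_def bi e_def expected_count_def S.prob_space)
    qed (auto simp: f_def bi e_def expected_count_def)
    finally show "(\<integral>\<omega>. real (parked_count len k (Suc T) {a..c} (x ## \<omega>)) \<partial>sample_stream L) = e a c + f x" .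
  qed
  also have "\<dots> = e a c + (\<integral>x. f x \<partial>sample_law n q L)"
    using f_int by (simp add: P.prob_space)
  also have "(\<integral>x. f x \<partial>sample_law n q L) = (\<Sum>i=1..n. q i * (LBINT b:{0..L}. f (b, i))) / L"
    using f_bd by (intro integral_sample_law[OF assms(1) f_meas]) auto
  also have "(\<Sum>i=1..n. q i * (LBINT b:{0..L}. f (b, i))) =
     (\<Sum>i=1..n. q i * (LBINT b:{a..c - len i}. of_bool (i = k) + e a b + e (b + len i) c - e a c))"
  proof (intro sum.cong refl arg_cong2[where f = "(*)"])
    fix i assume "i \<in> {1..n}"
    then have "1 \<le> len i" by (rule len_ge_1)
    \<comment> \<open>By \<open>0 \<le> a\<close> and \<open>c \<le> L\<close> every admissible left
      end point lies in the sampling window, so nothing is lost by the restriction to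
      \<open>{0..L}\<close>.\<close>
    then show "(LBINT b:{0..L}. f (b, i)) =
        (LBINT b:{a..c - len i}. of_bool (i = k) + e a b + e (b + len i) c - e a c)"
      using assms unfolding set_lebesgue_integral_def
      by (intro Bochner_Integration.integral_cong) (auto simp: f_def indicator_def)
  qed
  finally show ?thesis by (simp add: e_def)
qed

text \<open>The window is fixed, so this cannot be seen on a single stream. It holds for
  expectations because the left end points have constant density on the window and both intervals
  lie inside it; the induction carries this through the pieces created by parking.\<close>

lemma expected_count_shift:
  assumes "L > 0" "0 \<le> a" "a \<le> c" "c \<le> L"
  shows "expected_count L T a c = expected_count L T 0 (c - a)"
  using assms(2-)
proof (induction T arbitrary: a c)
  case 0
  then show ?case by (simp add: expected_count_def)
next
  case (Suc T)
  define r where "r = (\<lambda>x. expected_count L T 0 x)"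
  have "(LBINT b:{a..c - len i}. of_bool (i = k) + expected_count L T a b
       + expected_count L T (b + len i) c - expected_count L T a c) =
      (LBINT b:{0..(c - a) - len i}. of_bool (i = k) + expected_count L T 0 b
       + expected_count L T (b + len i) (c - a) - expected_count L T 0 (c - a))" if "i \<in> {1..n}" for i
  proof -
    have l: "1 \<le> len i" using that by (rule len_ge_1)
    have "(LBINT b:{a..c - len i}. of_bool (i = k) + expected_count L T a b
       + expected_count L T (b + len i) c - expected_count L T a c) =
      (LBINT b:{a..c - len i}. of_bool (i = k) + r (b - a) + r (c - a - len i - (b - a)) - r (c - a))"
    proof (intro set_lebesgue_integral_cong allI impI)
      fix b assume "b \<in> {a..c - len i}"
      then have "a \<le> b" "b + len i \<le> c" by auto
      then show "of_bool (i = k) + expected_count L T a b + expected_count L T (b + len i) c - expected_count L T a c =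
          of_bool (i = k) + r (b - a) + r (c - a - len i - (b - a)) - r (c - a)"
        using Suc.IH[of a b] Suc.IH[of "b + len i" c] Suc.IH[of a c] Suc.prems l
        by (simp add: r_def algebra_simps)
    qed simp
    also have "\<dots> = (LBINT b:{0..c - len i - a}. of_bool (i = k) + r b + r (c - a - len i - b) - r (c - a))"
      by (rule set_lebesgue_integral_shift)
    also have "\<dots> = (LBINT b:{0..c - a - len i}. of_bool (i = k) + expected_count L T 0 b
       + expected_count L T (b + len i) (c - a) - expected_count L T 0 (c - a))"
      (is "set_lebesgue_integral _ ?A _ = _")
    proof -
      have A: "?A = {0..c - a - len i}" by simp
      show ?thesis unfolding A
      proof (intro set_lebesgue_integral_cong allI impI)
        fix b assume "b \<in> {0..c - a - len i}"
        then show "of_bool (i = k) + r b + r (c - a - len i - b) - r (c - a) =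
            of_bool (i = k) + expected_count L T 0 b
              + expected_count L T (b + len i) (c - a) - expected_count L T 0 (c - a)"
          using Suc.IH[of "b + len i" "c - a"] Suc.prems l by (simp add: r_def algebra_simps)
      qed simp
    qed
    finally show ?thesis .
  qed
  then have "(\<Sum>i=1..n. q i * (LBINT b:{a..c - len i}. of_bool (i = k) + expected_count L T a b
       + expected_count L T (b + len i) c - expected_count L T a c)) =
      (\<Sum>i=1..n. q i * (LBINT b:{0..(c - a) - len i}. of_bool (i = k) + expected_count L T 0 b
       + expected_count L T (b + len i) (c - a) - expected_count L T 0 (c - a)))"
    by (intro sum.cong refl arg_cong2[where f = "(*)"])
  moreover have "expected_count L (Suc T) a c = expected_count L T a c +
    (\<Sum>i=1..n. q i * (LBINT b:{a..c - len i}. of_bool (i = k) + expected_count L T a b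
       + expected_count L T (b + len i) c - expected_count L T a c)) / L"
    using Suc.prems by (intro expected_count_Suc assms(1))
  moreover have "expected_count L (Suc T) 0 (c - a) = expected_count L T 0 (c - a) +
    (\<Sum>i=1..n. q i * (LBINT b:{0..(c - a) - len i}. of_bool (i = k) + expected_count L T 0 b
       + expected_count L T (b + len i) (c - a) - expected_count L T 0 (c - a))) / L"
    using Suc.prems by (intro expected_count_Suc assms(1)) auto
  ultimately show ?case
    by (simp only: Suc.IH[OF Suc.prems])
qed

text \<open>By translation invariance the right piece counts only through its length
  \<open>x - len i - b\<close>. Reflecting \<open>b\<close> then gives both pieces the same
  integral, whence the factor 2. Types too long to fit contribute nothing, which the
  \<open>max 0\<close> records.\<close>

lemma expected_count_rec:
  assumes "L > 0" "0 \<le> x" "x \<le> L"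
  defines "r \<equiv> \<lambda>T. expected_count L T 0"
  shows "r (Suc T) x = r T x + (q k * max 0 (x - len k) + 2 * (\<Sum>i=1..n. q i * (LBINT b:{0..x - len i}. r T b))
     - (\<Sum>i=1..n. q i * max 0 (x - len i)) * r T x) / L"
proof -
  have r_meas: "r T \<in> borel_measurable borel" unfolding r_def using assms(1) by measurable
  have r_bd: "0 \<le> r T y" "r T y \<le> max 0 y" for y
    using expected_count_bounds[OF assms(1), of T 0 y] by (auto simp: r_def)
  have "(LBINT b:{0..x - len i}. of_bool (i = k) + expected_count L T 0 b
       + expected_count L T (b + len i) x - expected_count L T 0 x) =
      max 0 (x - len i) * of_bool (i = k) + 2 * (LBINT b:{0..x - len i}. r T b) - max 0 (x - len i) * r T x"
    if "i \<in> {1..n}" for i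
  proof -
    have l: "1 \<le> len i" using that by (rule len_ge_1)
    let ?I = "{0..x - len i}"
    have c: "set_integrable lborel ?I (\<lambda>b. c)" for c :: real
      by (rule set_integrable_bounded_Icc) auto
    have i1: "set_integrable lborel ?I (r T)"
    proof (rule set_integrable_bounded_Icc[OF r_meas])
      show "\<bar>r T b\<bar> \<le> max 0 x" if "b \<in> ?I" for b
        using r_bd[of b] that l by auto
    qed
    have i2: "set_integrable lborel ?I (\<lambda>b. r T (x - len i - b))"
    proof (rule set_integrable_bounded_Icc)
      show "\<bar>r T (x - len i - b)\<bar> \<le> max 0 x" if "b \<in> ?I" for b
        using r_bd[of "x - len i - b"] that l by auto
    qed (use r_meas in measurable)
    have ci: "(LBINT b:?I. c) = max 0 (x - len i) * c" for c :: real
      by (cases "0 \<le> x - len i") (simp_all add: set_lebesgue_integral_def)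
    have "(LBINT b:?I. of_bool (i = k) + expected_count L T 0 b
       + expected_count L T (b + len i) x - expected_count L T 0 x) =
      (LBINT b:?I. of_bool (i = k) + r T b + r T (x - len i - b) - r T x)"
    proof (intro set_lebesgue_integral_cong allI impI)
      fix b assume "b \<in> ?I"
      then show "of_bool (i = k) + expected_count L T 0 b + expected_count L T (b + len i) x - expected_count L T 0 x =
         of_bool (i = k) + r T b + r T (x - len i - b) - r T x"
        using expected_count_shift[OF assms(1), of "b + len i" x T] l assms by (simp add: algebra_simps)
    qed simp
    also have "\<dots> = (LBINT b:?I. of_bool (i = k)) + (LBINT b:?I. r T b) + (LBINT b:?I. r T (x - len i - b)) - (LBINT b:?I. r T x)"
      using c i1 i2 by (simp add: set_integral_add set_integral_diff)
    finally show ?thesis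
      unfolding set_lebesgue_integral_reflect ci by simp
  qed
  then have "(\<Sum>i=1..n. q i * (LBINT b:{0..x - len i}. of_bool (i = k) + expected_count L T 0 b
       + expected_count L T (b + len i) x - expected_count L T 0 x)) =
     (\<Sum>i=1..n. q i * (max 0 (x - len i) * of_bool (i = k) + 2 * (LBINT b:{0..x - len i}. r T b)
        - max 0 (x - len i) * r T x))"
    by (intro sum.cong) auto
  also have "\<dots> = (\<Sum>i=1..n. if i = k then q k * max 0 (x - len k) else 0)
      + 2 * (\<Sum>i=1..n. q i * (LBINT b:{0..x - len i}. r T b))
      - (\<Sum>i=1..n. q i * max 0 (x - len i)) * r T x"
    unfolding sum_distrib_left sum_distrib_right sum.distrib[symmetric] sum_subtractf[symmetric]
    by (intro sum.cong) (auto simp: algebra_simps)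
  also have "(\<Sum>i=1..n. if i = k then q k * max 0 (x - len k) else 0) = q k * max 0 (x - len k)"
    using k_in by (subst sum.delta) auto
  finally show ?thesis
    using expected_count_Suc[OF assms(1), of 0 x T] assms(3) by (simp add: r_def)
qed

section \<open>The limit of infinitely many samples\<close>

lemma LIMSEQ_parked_count:
  assumes "\<omega> \<in> space (sample_stream L)"
  shows "(\<lambda>T. real (parked_count len k T {a..c} \<omega>)) \<longlonglongrightarrow> lim (\<lambda>T. real (parked_count len k T {a..c} \<omega>))"
proof -
  have "incseq (\<lambda>T. real (parked_count len k T {a..c} \<omega>))"
    using parked_count_mono[of len k "{a..c}" \<omega>] by (simp add: mono_def)
  from incseq_convergent[OF this, of "max 0 (c - a)"] parked_count_bound[OF assms]
  show ?thesis by (metis limI)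
qed

definition limit_count :: "real \<Rightarrow> real \<Rightarrow> real" where
  "limit_count L x = (\<integral>\<omega>. lim (\<lambda>T. real (parked_count len k T {0..x} \<omega>)) \<partial>sample_stream L)"

lemma LIMSEQ_expected_count:
  assumes "L > 0"
  shows "(\<lambda>T. expected_count L T 0 x) \<longlonglongrightarrow> limit_count L x"
proof -
  interpret prob_space "sample_stream L" using assms by (rule prob_space_sample_stream)
  have lim: "AE \<omega> in sample_stream L. (\<lambda>T. real (parked_count len k T {0..x} \<omega>))
      \<longlonglongrightarrow> lim (\<lambda>T. real (parked_count len k T {0..x} \<omega>))"
    using LIMSEQ_parked_count by blast
  show ?thesis
    unfolding expected_count_def limit_count_def
  proof (rule integral_dominated_convergence[where w = "\<lambda>_. max 0 x"])
    show "(\<lambda>\<omega>. lim (\<lambda>T. real (parked_count len k T {0..x} \<omega>))) \<in> borel_measurable (sample_stream L)"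
      by (rule borel_measurable_LIMSEQ_metric[OF measurable_parked_count' LIMSEQ_parked_count])
    show "AE \<omega> in sample_stream L. norm (real (parked_count len k T {0..x} \<omega>)) \<le> max 0 x" for T
      using parked_count_bound[of _ L T 0 x] by (intro AE_I2) simp
  qed (use lim in simp_all)
qed

lemma limit_count_bounds:
  assumes "L > 0"
  shows "0 \<le> limit_count L x" "limit_count L x \<le> max 0 x"
  using LIMSEQ_le_const[OF LIMSEQ_expected_count[OF assms, of x], of 0]
    LIMSEQ_le_const2[OF LIMSEQ_expected_count[OF assms, of x], of "max 0 x"]
    expected_count_bounds[OF assms, of _ 0 x]
  by auto

lemma measurable_limit_count:
  assumes "L > 0"
  shows "limit_count L \<in> borel_measurable borel"
  by (rule borel_measurable_LIMSEQ_metric[OF _ LIMSEQ_expected_count[OF assms]])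
    (use assms in measurable)

text \<open>The counts at \<open>T\<close> and \<open>Suc T\<close> have the same limit, so the
  increment in \<open>expected_count_rec\<close> tends to 0. Its prefactor \<open>1 / L\<close> can
  then be dropped, and the window disappears from the coefficients.\<close>

lemma limit_count_rec:
  assumes "L > 0" "0 \<le> x" "x \<le> L"
  shows "(\<Sum>i=1..n. q i * max 0 (x - len i)) * limit_count L x =
     q k * max 0 (x - len k) + 2 * (\<Sum>i=1..n. q i * (LBINT b:{0..x - len i}. limit_count L b))"
    (is "?Z * _ = ?Q + 2 * (\<Sum>i=1..n. q i * ?S i)")
proof -
  let ?r = "\<lambda>T. expected_count L T 0"
  note lim = LIMSEQ_expected_count[OF assms(1)]
  have S: "(\<lambda>T. LBINT b:{0..y}. ?r T b) \<longlonglongrightarrow> (LBINT b:{0..y}. limit_count L b)" for y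
    unfolding set_lebesgue_integral_def
  proof (rule integral_dominated_convergence[where w = "\<lambda>b. max 0 y * indicator {0..y} b"])
    show "integrable lborel (\<lambda>b. max 0 y * indicator {0..y} b :: real)"
      by (intro integrable_mult_right integrable_real_indicator) (auto simp: emeasure_lborel_Icc_eq)
    show "AE b in lborel. (\<lambda>T. indicat_real {0..y} b *\<^sub>R ?r T b) \<longlonglongrightarrow> indicat_real {0..y} b *\<^sub>R limit_count L b"
      by (intro AE_I2 tendsto_scaleR tendsto_const lim)
    show "AE b in lborel. norm (indicat_real {0..y} b *\<^sub>R ?r T b) \<le> max 0 y * indicator {0..y} b" for T
    proof (intro AE_I2)
      fix b show "norm (indicat_real {0..y} b *\<^sub>R ?r T b) \<le> max 0 y * indicator {0..y} b"
        using expected_count_bounds[OF assms(1), of T 0 b] by (auto simp: indicator_def)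
    qed
    show "(\<lambda>b. indicat_real {0..y} b *\<^sub>R limit_count L b) \<in> borel_measurable lborel"
      using measurable_limit_count[OF assms(1)] by measurable
    show "(\<lambda>b. indicat_real {0..y} b *\<^sub>R ?r T b) \<in> borel_measurable lborel" for T
      using assms(1) by measurable
  qed
  have "(\<lambda>T. ?r T x + (?Q + 2 * (\<Sum>i=1..n. q i * (LBINT b:{0..x - len i}. ?r T b)) - ?Z * ?r T x) / L)
      \<longlonglongrightarrow> limit_count L x + (?Q + 2 * (\<Sum>i=1..n. q i * ?S i) - ?Z * limit_count L x) / L"
    using assms(1) by (intro tendsto_intros lim S) auto
  then have "(\<lambda>T. ?r (Suc T) x) \<longlonglongrightarrow> limit_count L x + (?Q + 2 * (\<Sum>i=1..n. q i * ?S i) - ?Z * limit_count L x) / L"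
    by (simp only: expected_count_rec[OF assms])
  from LIMSEQ_unique[OF this LIMSEQ_Suc[OF lim]]
  show ?thesis using assms(1) by simp
qed

text \<open>The limiting recursion is void here, as its coefficient vanishes for
  \<open>x \<le> 1\<close>, so the argument returns to finite \<open>T\<close>. At
  \<open>x = 1\<close> a unit segment still fits at \<open>b = 0\<close>, but only with probability
  zero: the claim holds in expectation and not on every stream.\<close>

lemma limit_count_eq_0:
  assumes "L > 0" "x \<le> 1" "x \<le> L"
  shows "limit_count L x = 0"
proof (cases "0 \<le> x")
  case True
  have "expected_count L T 0 x = 0" for T
  proof (induction T)
    case (Suc T)
    have neg: "x - len i \<le> 0" if "i \<in> {1..n}" for i using len_ge_1[OF that] assms by simp
    have "(LBINT b:{0..x - len i}. expected_count L T 0 b) = (LBINT b:{0..x - len i}. 0)" if "i \<in> {1..n}" for i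
    proof (intro set_lebesgue_integral_cong allI impI)
      fix b assume "b \<in> {0..x - len i}"
      then have "b = 0" using neg[OF that] by auto
      then show "expected_count L T 0 b = 0" using expected_count_bounds[OF assms(1), of T 0 0] by simp
    qed simp
    then show ?case
      using expected_count_rec[OF assms(1) True assms(3), of T] Suc.IH neg[OF k_in]
      by (simp add: set_lebesgue_integral_def)
  qed (simp add: expected_count_def)
  then show ?thesis
    using LIMSEQ_unique[OF LIMSEQ_expected_count[OF assms(1), of x], of 0] by simp
next
  case False
  then show ?thesis using limit_count_bounds[OF assms(1), of x] by simp
qed

lemma normalizer_pos:
  assumes "x > 1"
  shows "(\<Sum>i=1..n. q i * max 0 (x - len i)) > 0"
proof (rule sum_pos2)
  show "0 < q 1 * max 0 (x - len 1)" using q_pos[of 1] n_pos len_1 assms by auto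
  show "0 \<le> q i * max 0 (x - len i)" if "i \<in> {1..n}" for i
    using q_pos[OF that] by simp
qed (use n_pos in auto)

text \<open>The recursion determines the limit on \<open>[0, m + 1]\<close> from its values on \<open>[0, m]\<close>, so the limit
  does not depend on the interval from which the driving samples are drawn.\<close>

lemma limit_count_cong:
  assumes "L > 0" "L' > 0" "x \<le> L" "x \<le> L'"
  shows "limit_count L x = limit_count L' x"
proof -
  have "limit_count L x = limit_count L' x" if "x \<le> real m" "x \<le> L" "x \<le> L'" for m :: nat and x
    using that
  proof (induction m arbitrary: x)
    case 0
    then show ?case using assms by (simp add: limit_count_eq_0)
  next
    case (Suc m)
    show ?case
    proof (cases "x \<le> 1")
      case True
      then show ?thesis using assms Suc.prems by (simp add: limit_count_eq_0)
    next
      case False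
      have "(LBINT b:{0..x - len i}. limit_count L b) = (LBINT b:{0..x - len i}. limit_count L' b)"
        if "i \<in> {1..n}" for i
        using len_ge_1[OF that] Suc.prems
        by (intro set_lebesgue_integral_cong allI impI Suc.IH) auto
      then have "(\<Sum>i=1..n. q i * (LBINT b:{0..x - len i}. limit_count L b)) =
          (\<Sum>i=1..n. q i * (LBINT b:{0..x - len i}. limit_count L' b))"
        by (intro sum.cong) auto
      then have "(\<Sum>i=1..n. q i * max 0 (x - len i)) * limit_count L x =
          (\<Sum>i=1..n. q i * max 0 (x - len i)) * limit_count L' x"
        using limit_count_rec[OF assms(1), of x] limit_count_rec[OF assms(2), of x] False Suc.prems
        by simp
      then show ?thesis using normalizer_pos[of x] False by simp
    qed
  qed
  moreover obtain m :: nat where "x \<le> real m" using real_arch_simple by blast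
  ultimately show ?thesis using assms by blast
qed

section \<open>Saturation as a function of the interval length\<close>

lemma inj_on_len: "inj_on len {1..n}"
  using len_strict_mono strict_mono_on_imp_inj_on by blast

text \<open>The integrands agree on every stream, so the identity holds even for those
  \<open>L\<close> at which \<open>sample_law\<close> is no probability measure.\<close>

lemma expected_saturation_eq_limit_count:
  "expected_saturation n len q k L = limit_count L L"
  unfolding expected_saturation_def limit_count_def
proof (intro Bochner_Integration.integral_cong refl)
  fix \<omega> assume "\<omega> \<in> space (sample_stream L)"
  then have \<omega>: "\<omega> \<in> streams (UNIV \<times> {1..n})" by (simp only: space_sample_stream)
  have "card {A \<in> snd (parking_state len L \<omega> T). measure lborel A = len k} =
      parked_count len k T {0..L} \<omega>" for T
    unfolding parking_state_eq_park_run
    using card_park_run[of "{}" "{0..L}" \<omega> "{1..n}" len k T] \<omega> inj_on_len k_in len_pos_ball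
    by (simp del: One_nat_def)
  then show "saturation_number len k L \<omega> = lim (\<lambda>T. real (parked_count len k T {0..L} \<omega>))"
    by (simp add: saturation_number_def)
qed

text \<open>The value 0 at nonpositive lengths replaces the junk produced there by the sampling law,
  so that bounds and integrals starting at 0 need no exceptions.\<close>

definition saturation :: "real \<Rightarrow> real" where
  "saturation x = (if 0 < x then expected_saturation n len q k x else 0)"

text \<open>Under \<open>expected_saturation\<close> the measure itself changes with the length.
  Here a single window serves all lengths up to \<open>L\<close>, so properties of
  \<open>limit_count L\<close> become properties of the saturation function.\<close>

lemma saturation_eq_limit_count:
  assumes "L > 0" "x \<le> L"
  shows "saturation x = limit_count L x"
proof (cases "0 < x")
  case True
  then show ?thesis
    using assms limit_count_cong[of x L x] by (simp add: saturation_def expected_saturation_eq_limit_count)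
next
  case False
  then show ?thesis
    using limit_count_bounds[OF assms(1), of x] by (simp add: saturation_def)
qed

lemma saturation_bounds: "0 \<le> saturation x" "saturation x \<le> max 0 x"
  using limit_count_bounds[of "max 1 x" x] saturation_eq_limit_count[of "max 1 x" x] by auto

text \<open>At each point the functions with integer windows are eventually constant, equal to the
  saturation, so it is their pointwise limit.\<close>

lemma measurable_saturation [measurable]: "saturation \<in> borel_measurable borel"
proof (rule borel_measurable_LIMSEQ_metric)
  show "limit_count (real (Suc m)) \<in> borel_measurable borel" for m
    by (rule measurable_limit_count) simp
  show "(\<lambda>m. limit_count (real (Suc m)) x) \<longlonglongrightarrow> saturation x" for x
  proof (rule tendsto_eventually)
    show "\<forall>\<^sub>F m in sequentially. limit_count (real (Suc m)) x = saturation x"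
      using eventually_ge_at_top[of "nat \<lceil>x\<rceil>"]
    proof eventually_elim
      case (elim m)
      then have "x \<le> real (Suc m)" by linarith
      then show ?case by (intro saturation_eq_limit_count[symmetric]) auto
    qed
  qed
qed

lemma saturation_rec:
  assumes "0 \<le> x"
  shows "(\<Sum>i=1..n. q i * max 0 (x - len i)) * saturation x =
     q k * max 0 (x - len k) + 2 * (\<Sum>i=1..n. q i * (LBINT b:{0..x - len i}. saturation b))"
proof -
  let ?L = "max 1 x"
  have "(LBINT b:{0..x - len i}. saturation b) = (LBINT b:{0..x - len i}. limit_count ?L b)"
    if "i \<in> {1..n}" for i
    using len_ge_1[OF that]
    by (intro set_lebesgue_integral_cong allI impI saturation_eq_limit_count) auto
  then have "(\<Sum>i=1..n. q i * (LBINT b:{0..x - len i}. saturation b)) =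
      (\<Sum>i=1..n. q i * (LBINT b:{0..x - len i}. limit_count ?L b))"
    by (intro sum.cong) auto
  then show ?thesis
    using limit_count_rec[of ?L x] saturation_eq_limit_count[of ?L x] assms by simp
qed

end

section \<open>The exponential integral and Laplace transforms\<close>

text \<open>The value 1 removes the singularity, which makes the fundamental theorem available up to
  the end point 0.\<close>

definition Ein_integrand :: "real \<Rightarrow> real" where
  "Ein_integrand t = (if t = 0 then 1 else (1 - exp (- t)) / t)"

lemma continuous_Ein_integrand: "continuous_on A Ein_integrand"
proof (intro continuous_at_imp_continuous_on ballI)
  fix x :: real
  show "isCont Ein_integrand x"
  proof (cases "x = 0")
    case True
    \<comment> \<open>The integrand is the difference quotient of \<open>- exp (- t)\<close> at
      0.\<close>
    have "((\<lambda>t::real. - exp (- t)) has_real_derivative 1) (at 0)"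
      by (auto intro!: derivative_eq_intros)
    then have "((\<lambda>t::real. (1 - exp (- t)) / t) \<longlongrightarrow> 1) (at 0)"
      by (simp add: has_field_derivative_iff)
    then have "(Ein_integrand \<longlongrightarrow> 1) (at 0)"
      by (rule Lim_transform_eventually) (auto simp: eventually_at_filter Ein_integrand_def)
    then show ?thesis using True by (simp add: isCont_def Ein_integrand_def)
  next
    case False
    have "isCont (\<lambda>t. (1 - exp (- t)) / t) x" using False by (intro continuous_intros) auto
    moreover have "\<forall>\<^sub>F t in nhds x. Ein_integrand t = (1 - exp (- t)) / t"
      using False eventually_nhds_in_open[of "- {0}" x] by (auto elim!: eventually_mono simp: Ein_integrand_def)
    ultimately show ?thesis by (simp add: isCont_cong)
  qed
qed

lemma Ein_eq_integral:
  assumes "0 \<le> z"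
  shows "Ein z = integral {0..z} Ein_integrand"
proof -
  have "Ein z = (LBINT t=0..z. Ein_integrand t)"
    unfolding Ein_def using assms
    by (intro interval_integral_cong) (auto simp: Ein_integrand_def einterval_iff min_def)
  also have "\<dots> = integral {0..z} Ein_integrand"
    using assms interval_integral_eq_integral[of 0 z Ein_integrand]
      borel_integrable_atLeastAtMost'[OF continuous_Ein_integrand, of 0 z]
    by (simp add: zero_ereal_def)
  finally show ?thesis .
qed

lemma Ein_has_real_derivative_within:
  assumes "0 \<le> z" "z \<le> b"
  shows "(Ein has_real_derivative Ein_integrand z) (at z within {0..b})"
proof -
  have "((\<lambda>z. integral {0..z} Ein_integrand) has_real_derivative Ein_integrand z) (at z within {0..b})"
    using assms by (intro integral_has_real_derivative continuous_Ein_integrand) auto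
  then show ?thesis
    by (rule has_field_derivative_transform_within[OF _ zero_less_one]) (use assms Ein_eq_integral in auto)
qed

lemma Ein_has_real_derivative [derivative_intros]:
  assumes "0 < z"
  shows "(Ein has_real_derivative (1 - exp (- z)) / z) (at z)"
proof -
  have "(Ein has_real_derivative Ein_integrand z) (at z within {0<..<z + 1})"
    using Ein_has_real_derivative_within[of z "z + 1"] assms by (auto elim: has_field_derivative_subset)
  then show ?thesis using assms by (simp add: at_within_open[of z "{0<..<z + 1}"] Ein_integrand_def)
qed

lemma Ein_tendsto_0: "(Ein \<longlongrightarrow> 0) (at_right 0)"
proof -
  have "(Ein \<longlongrightarrow> Ein 0) (at 0 within {0..1})"
    using DERIV_continuous[OF Ein_has_real_derivative_within[of 0 1]] by (simp add: continuous_within)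
  then have "(Ein \<longlongrightarrow> Ein 0) (at_right 0)"
    by (simp add: at_within_Icc_at_right)
  then show ?thesis by (simp add: Ein_eq_integral)
qed

text \<open>Supplies the decay that later absorbs a factor \<open>s\<^sup>2\<close>. The derivative
  of \<open>Ein z - ln z\<close> is \<open>- exp (- z) / z\<close>; subtracting
  \<open>exp (- z)\<close> adds \<open>exp (- z)\<close> to it, which outweighs the loss for
  \<open>z \<ge> 1\<close>.\<close>

lemma Ein_ge_ln:
  assumes "1 \<le> z"
  shows "ln z - 1 \<le> Ein z"
proof -
  have "Ein 1 - ln 1 - exp (- 1) \<le> Ein z - ln z - exp (- z)"
  proof (rule DERIV_nonneg_imp_nondecreasing[OF assms])
    fix x :: real assume x: "1 \<le> x" "x \<le> z"
    have "((\<lambda>z. Ein z - ln z - exp (- z)) has_real_derivative (1 - exp (- x)) / x - 1 / x + exp (- x)) (at x)"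
      using x by (auto intro!: derivative_eq_intros)
    moreover have "(1 - exp (- x)) / x - 1 / x + exp (- x) = exp (- x) * (1 - 1 / x)"
      using x by (simp add: field_simps)
    moreover have "0 \<le> exp (- x) * (1 - 1 / x)" using x by simp
    ultimately show "\<exists>y. ((\<lambda>z. Ein z - ln z - exp (- z)) has_real_derivative y) (at x) \<and> 0 \<le> y"
      by metis
  qed
  moreover have "0 \<le> Ein 1"
    unfolding Ein_eq_integral[OF zero_le_one]
    by (intro integral_nonneg integrable_continuous_real continuous_Ein_integrand)
      (auto simp: Ein_integrand_def)
  moreover have "exp (- 1) \<le> (1::real)" "0 < exp (- z)" by simp_all
  ultimately show ?thesis unfolding ln_one by linarith
qed

lemma has_bochner_integral_power_exp:
  assumes "0 < (s::real)"
  shows "has_bochner_integral lborel (\<lambda>x. indicator {0..} x * (x ^ i * exp (- (s * x)))) (fact i / s ^ Suc i)"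
proof (rule has_bochner_integral_nn_integral)
  have "(\<integral>\<^sup>+x. ennreal (indicator {0..} x * (x ^ i * exp (- (s * x)))) \<partial>lborel) =
      (\<integral>\<^sup>+x. ennreal (1 / s) * ennreal (erlang_density 0 s x * x ^ i) \<partial>lborel)"
    \<comment> \<open>\<open>erlang_density 0 s\<close> is the exponential density
      \<open>s * exp (- (s * x))\<close>, so the integral is its moment of order \<open>i\<close>
      divided by \<open>s\<close>.\<close>
    using assms by (intro nn_integral_cong)
      (auto simp: erlang_density_def indicator_def ennreal_mult[symmetric])
  also have "\<dots> = ennreal (1 / s) * ennreal (fact i / s ^ i)"
    using nn_integral_erlang_ith_moment[OF assms, of 0 i] by (subst nn_integral_cmult) auto
  also have "\<dots> = ennreal (fact i / s ^ Suc i)"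
    using assms by (simp add: ennreal_mult[symmetric])
  finally show "(\<integral>\<^sup>+x. ennreal (indicator {0..} x * (x ^ i * exp (- (s * x)))) \<partial>lborel) = ennreal (fact i / s ^ Suc i)" .
qed (use assms in \<open>auto simp: indicator_def\<close>)

lemma has_bochner_integral_power_exp_shift:
  assumes "0 < (s::real)"
  shows "has_bochner_integral lborel (\<lambda>x. indicator {c..} x * ((x - c) ^ i * exp (- (s * x))))
    (exp (- (s * c)) * (fact i / s ^ Suc i))"
proof -
  have "has_bochner_integral lborel (\<lambda>x. indicator {0..} (- c + 1 * x) * ((- c + 1 * x) ^ i * exp (- (s * (- c + 1 * x)))))
      (fact i / s ^ Suc i)"
    using has_bochner_integral_power_exp[OF assms, of i]
    by (subst (asm) lborel_has_bochner_integral_real_affine_iff[of 1 _ _ "- c"]) auto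
  then have "has_bochner_integral lborel (\<lambda>x. exp (- (s * c)) *
      (indicator {0..} (- c + 1 * x) * ((- c + 1 * x) ^ i * exp (- (s * (- c + 1 * x))))))
      (exp (- (s * c)) * (fact i / s ^ Suc i))"
    by (rule has_bochner_integral_mult_right)
  moreover have "exp (- (s * c)) * (indicator {0..} (- c + 1 * x) * ((- c + 1 * x) ^ i * exp (- (s * (- c + 1 * x))))) =
      indicator {c..} x * ((x - c) ^ i * exp (- (s * x)))" for x
  proof -
    have "exp (- (s * c)) * exp (- (s * (- c + 1 * x))) = exp (- (s * x))"
      unfolding exp_add[symmetric] by (rule arg_cong[where f = exp]) (simp add: algebra_simps)
    then show ?thesis by (auto simp: indicator_def)
  qed
  ultimately show ?thesis by (simp only:)
qed

section \<open>Laplace transforms of functions of linear growth\<close>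

definition laplace :: "(real \<Rightarrow> real) \<Rightarrow> real \<Rightarrow> real" where
  "laplace \<phi> s = (\<integral>x. \<phi> x * exp (- (s * x)) \<partial>lborel)"

text \<open>The bound forces \<open>\<phi>\<close> to vanish on the negative axis, so that
  \<open>laplace\<close>, an integral over the whole line, is the usual one-sided transform.\<close>

locale linear_growth =
  fixes \<phi> :: "real \<Rightarrow> real"
  assumes meas [measurable]: "\<phi> \<in> borel_measurable borel"
    and bound: "\<bar>\<phi> x\<bar> \<le> indicator {0..} x * x"
begin

lemma integrable_moment:
  assumes "0 < s"
  shows "integrable lborel (\<lambda>x. x ^ i * (\<phi> x * exp (- (s * x))))"
proof (rule Bochner_Integration.integrable_bound)
  show "integrable lborel (\<lambda>x. indicator {0..} x * (x ^ Suc i * exp (- (s * x))))"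
    using has_bochner_integral_power_exp[OF assms, of "Suc i"] by (simp add: has_bochner_integral_iff)
  show "AE x in lborel. norm (x ^ i * (\<phi> x * exp (- (s * x)))) \<le> norm (indicator {0..} x * (x ^ Suc i * exp (- (s * x))))"
  proof (intro AE_I2)
    fix x
    have "\<bar>x ^ i\<bar> * (\<bar>\<phi> x\<bar> * exp (- (s * x))) \<le> \<bar>x ^ i\<bar> * ((indicator {0..} x * x) * exp (- (s * x)))"
      using bound by (intro mult_left_mono mult_right_mono) auto
    then show "norm (x ^ i * (\<phi> x * exp (- (s * x)))) \<le> norm (indicator {0..} x * (x ^ Suc i * exp (- (s * x))))"
      by (auto simp: indicator_def abs_mult mult_ac power_abs)
  qed
qed measurable

text \<open>Differentiation under the integral by a quadratic estimate: the second-order remainder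
  of the exponential bounds the error by \<open>d\<^sup>2\<close> times a constant independent of
  \<open>d\<close>.\<close>

lemma laplace_has_real_derivative:
  assumes "0 < s"
  shows "(laplace \<phi> has_real_derivative - (\<integral>x. x * (\<phi> x * exp (- (s * x))) \<partial>lborel)) (at s)"
proof -
  \<comment> \<open>For \<open>\<bar>d\<bar> \<le> s / 2\<close> the Taylor factor
    \<open>exp (\<bar>d\<bar> * x)\<close> costs at most half of the decay
    \<open>exp (- (s * x))\<close>, which leaves a second moment at \<open>s / 2\<close>.\<close>
  define K where "K = (\<integral>x. \<bar>x ^ 2 * (\<phi> x * exp (- (s / 2 * x)))\<bar> \<partial>lborel)"
  let ?D = "\<integral>x. x * (\<phi> x * exp (- (s * x))) \<partial>lborel"
  have Taylor: "\<bar>exp u - 1 - u\<bar> \<le> u ^ 2 * exp \<bar>u\<bar>" for u :: real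
  proof -
    obtain t where t: "\<bar>t\<bar> \<le> \<bar>u\<bar>" "exp u = (\<Sum>m<2. u ^ m / fact m) + (exp t / fact 2) * u ^ 2"
      using Maclaurin_exp_le by blast
    have "exp u - 1 - u = exp t / 2 * u ^ 2"
      using t(2) by (simp add: numeral_2_eq_2)
    then have "\<bar>exp u - 1 - u\<bar> = exp t / 2 * u ^ 2" by (simp only: abs_mult) simp
    also have "\<dots> \<le> exp \<bar>u\<bar> * u ^ 2"
    proof (rule mult_right_mono)
      have "exp t \<le> exp \<bar>u\<bar>" using t(1) by simp
      then show "exp t / 2 \<le> exp \<bar>u\<bar>" using exp_gt_zero[of t] by linarith
    qed simp
    finally show ?thesis by (simp add: mult.commute)
  qed
  have main: "\<bar>laplace \<phi> (s + d) - laplace \<phi> s + d * ?D\<bar> \<le> d\<^sup>2 * K" if d: "\<bar>d\<bar> \<le> s / 2" for d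
  proof -
    have i1: "integrable lborel (\<lambda>x. \<phi> x * exp (- ((s + d) * x)))"
      using integrable_moment[of "s + d" 0] d assms by simp
    have i2: "integrable lborel (\<lambda>x. \<phi> x * exp (- (s * x)))"
      using integrable_moment[of s 0] assms by simp
    have i3: "integrable lborel (\<lambda>x. x * (\<phi> x * exp (- (s * x))))"
      using integrable_moment[of s 1] assms by simp
    have i4: "integrable lborel (\<lambda>x. \<bar>x ^ 2 * (\<phi> x * exp (- (s / 2 * x)))\<bar>)"
      using integrable_moment[of "s / 2" 2] assms by (intro integrable_abs) simp
    have "\<bar>laplace \<phi> (s + d) - laplace \<phi> s + d * ?D\<bar> =
      \<bar>\<integral>x. \<phi> x * exp (- ((s + d) * x)) - \<phi> x * exp (- (s * x)) + d * (x * (\<phi> x * exp (- (s * x)))) \<partial>lborel\<bar>"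
      unfolding laplace_def using i1 i2 i3 by simp
    also have "\<dots> \<le> (\<integral>x. \<bar>\<phi> x * exp (- ((s + d) * x)) - \<phi> x * exp (- (s * x)) + d * (x * (\<phi> x * exp (- (s * x))))\<bar> \<partial>lborel)"
      by (rule integral_abs_bound)
    also have "\<dots> \<le> (\<integral>x. d\<^sup>2 * \<bar>x ^ 2 * (\<phi> x * exp (- (s / 2 * x)))\<bar> \<partial>lborel)"
    proof (rule integral_mono)
      fix x :: real
      show "\<bar>\<phi> x * exp (- ((s + d) * x)) - \<phi> x * exp (- (s * x)) + d * (x * (\<phi> x * exp (- (s * x))))\<bar>
        \<le> d\<^sup>2 * \<bar>x ^ 2 * (\<phi> x * exp (- (s / 2 * x)))\<bar>"
      proof (cases "0 \<le> x")
        case True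
        have e: "exp (- ((s + d) * x)) = exp (- (s * x)) * exp (- d * x)"
          unfolding exp_add[symmetric] by (rule arg_cong[where f = exp]) (simp add: algebra_simps)
        have "\<phi> x * exp (- ((s + d) * x)) - \<phi> x * exp (- (s * x)) + d * (x * (\<phi> x * exp (- (s * x)))) =
            \<phi> x * exp (- (s * x)) * (exp (- d * x) - 1 - (- d * x))"
          unfolding e by (simp add: algebra_simps)
        then have "\<bar>\<phi> x * exp (- ((s + d) * x)) - \<phi> x * exp (- (s * x)) + d * (x * (\<phi> x * exp (- (s * x))))\<bar> =
            \<bar>\<phi> x * exp (- (s * x)) * (exp (- d * x) - 1 - (- d * x))\<bar>"
          by (rule arg_cong)
        also have "\<dots> \<le> \<bar>\<phi> x * exp (- (s * x))\<bar> * ((- d * x)\<^sup>2 * exp \<bar>- d * x\<bar>)"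
          unfolding abs_mult[of "\<phi> x * exp (- (s * x))"] by (intro mult_left_mono Taylor) auto
        also have "\<dots> = d\<^sup>2 * x\<^sup>2 * \<bar>\<phi> x\<bar> * (exp (- (s * x)) * exp (\<bar>d\<bar> * x))"
          using True by (simp add: abs_mult power_mult_distrib mult_ac)
        also have "exp (- (s * x)) * exp (\<bar>d\<bar> * x) = exp (\<bar>d\<bar> * x - s * x)"
          unfolding exp_add[symmetric] by simp
        also have "d\<^sup>2 * x\<^sup>2 * \<bar>\<phi> x\<bar> * exp (\<bar>d\<bar> * x - s * x) \<le>
            d\<^sup>2 * x\<^sup>2 * \<bar>\<phi> x\<bar> * exp (- (s / 2 * x))"
          using mult_right_mono[OF d True] by (intro mult_left_mono) auto
        finally show ?thesis by (simp add: abs_mult mult_ac)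
      next
        case False
        then have "\<phi> x = 0" using bound[of x] by simp
        then show ?thesis by simp
      qed
    qed (use i1 i2 i3 i4 in auto)
    also have "\<dots> = d\<^sup>2 * K" unfolding K_def by simp
    finally show ?thesis .
  qed
  have "((\<lambda>d. (laplace \<phi> (s + d) - laplace \<phi> s) / d + ?D) \<longlongrightarrow> 0) (at 0)"
  proof (rule Lim_null_comparison)
    show "\<forall>\<^sub>F d in at 0. norm ((laplace \<phi> (s + d) - laplace \<phi> s) / d + ?D) \<le> \<bar>d\<bar> * K"
      unfolding eventually_at
    proof (intro exI[of _ "s / 2"] conjI ballI impI)
      fix d :: real assume "d \<noteq> 0 \<and> dist d 0 < s / 2"
      then have d: "d \<noteq> 0" "\<bar>d\<bar> \<le> s / 2" by auto
      have "\<bar>(laplace \<phi> (s + d) - laplace \<phi> s) / d + ?D\<bar> = \<bar>laplace \<phi> (s + d) - laplace \<phi> s + d * ?D\<bar> / \<bar>d\<bar>"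
        using d(1) by (simp add: abs_divide[symmetric] add_divide_distrib)
      also have "\<dots> \<le> d\<^sup>2 * K / \<bar>d\<bar>"
        using main[OF d(2)] by (intro divide_right_mono) auto
      also have "d\<^sup>2 * K / \<bar>d\<bar> = \<bar>d\<bar> * K"
        using d(1) by (cases "d > 0") (auto simp: power2_eq_square)
      finally show "norm ((laplace \<phi> (s + d) - laplace \<phi> s) / d + ?D) \<le> \<bar>d\<bar> * K" by simp
    qed (use assms in simp)
    show "((\<lambda>d. \<bar>d\<bar> * K) \<longlongrightarrow> 0) (at 0)"
      by (auto intro!: tendsto_eq_intros)
  qed
  then have "((\<lambda>d. (laplace \<phi> (s + d) - laplace \<phi> s) / d + ?D - ?D) \<longlongrightarrow> 0 - ?D) (at 0)"
    by (intro tendsto_intros)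
  then show ?thesis by (simp add: DERIV_def)
qed

text \<open>The transform of \<open>C * x\<close> on the half line is \<open>C / s\<^sup>2\<close>.
  An error of at most \<open>\<epsilon> / 2 * x + K\<close> becomes
  \<open>\<epsilon> / 2 + K * s\<close> after transformation and multiplication by
  \<open>s\<^sup>2\<close>, and the second part vanishes with \<open>s\<close>.\<close>

lemma abelian:
  assumes lim: "((\<lambda>x. \<phi> x / x) \<longlongrightarrow> C) at_top"
  shows "((\<lambda>s. s\<^sup>2 * laplace \<phi> s) \<longlongrightarrow> C) (at_right 0)"
proof (rule tendstoI)
  fix \<epsilon> :: real assume \<epsilon>: "0 < \<epsilon>"
  have "\<forall>\<^sub>F x in at_top. dist (\<phi> x / x) C < \<epsilon> / 2"
    using tendstoD[OF lim, of "\<epsilon> / 2"] \<epsilon> by simp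
  then obtain X0 where X0: "\<And>x. X0 \<le> x \<Longrightarrow> dist (\<phi> x / x) C < \<epsilon> / 2"
    by (auto simp: eventually_at_top_linorder)
  define X where "X = max 1 X0"
  \<comment> \<open>Below \<open>X\<close> only the crude bound
    \<open>(1 + \<bar>C\<bar>) * x\<close> on the error is known.\<close>
  define K where "K = (1 + \<bar>C\<bar>) * X"
  have K: "0 \<le> K" by (auto simp: K_def X_def)
  have bd: "\<bar>\<phi> x - C * x\<bar> \<le> \<epsilon> / 2 * x + K" if "0 \<le> x" for x
  proof (cases "X \<le> x")
    case True
    then have x: "0 < x" "X0 \<le> x" by (auto simp: X_def)
    have "\<bar>\<phi> x - C * x\<bar> = \<bar>\<phi> x / x - C\<bar> * x"
      using x(1) by (simp add: field_simps flip: abs_mult_pos)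
    also have "\<dots> \<le> \<epsilon> / 2 * x"
      using X0[OF x(2)] x(1) by (intro mult_right_mono) (auto simp: dist_real_def)
    finally show ?thesis using K by simp
  next
    case False
    have "\<bar>\<phi> x - C * x\<bar> \<le> \<bar>\<phi> x\<bar> + \<bar>C * x\<bar>" by (rule abs_triangle_ineq4)
    also have "\<dots> \<le> (1 + \<bar>C\<bar>) * x" using bound[of x] that by (simp add: abs_mult algebra_simps)
    also have "\<dots> \<le> K" unfolding K_def using False by (intro mult_left_mono) auto
    also have "\<dots> \<le> \<epsilon> / 2 * x + K" using that \<epsilon> by simp
    finally show ?thesis .
  qed
  have main: "dist (s\<^sup>2 * laplace \<phi> s) C \<le> \<epsilon> / 2 + K * s" if s: "0 < s" for s
  proof -
    note m0 = has_bochner_integral_power_exp[OF s, of 0] and m1 = has_bochner_integral_power_exp[OF s, of 1]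
    let ?m0 = "\<lambda>x. indicator {0..} x * (x ^ 0 * exp (- (s * x)))"
      and ?m1 = "\<lambda>x. indicator {0..} x * (x ^ 1 * exp (- (s * x)))"
    have i: "integrable lborel (\<lambda>x. \<phi> x * exp (- (s * x)))" "integrable lborel ?m0" "integrable lborel ?m1"
      using integrable_moment[OF s, of 0] m0 m1 by (simp_all only: has_bochner_integral_iff power_0 mult_1)
    have v: "integral\<^sup>L lborel ?m0 = 1 / s" "integral\<^sup>L lborel ?m1 = 1 / s\<^sup>2"
      using m0 m1 by (simp_all add: has_bochner_integral_iff power2_eq_square)
    have "\<bar>laplace \<phi> s - C / s\<^sup>2\<bar> = \<bar>\<integral>x. \<phi> x * exp (- (s * x)) - C * ?m1 x \<partial>lborel\<bar>"
      unfolding laplace_def using i v by (subst Bochner_Integration.integral_diff) auto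
    also have "\<dots> \<le> (\<integral>x. \<bar>\<phi> x * exp (- (s * x)) - C * ?m1 x\<bar> \<partial>lborel)"
      by (rule integral_abs_bound)
    also have "\<dots> \<le> (\<integral>x. \<epsilon> / 2 * ?m1 x + K * ?m0 x \<partial>lborel)"
    proof (rule integral_mono)
      fix x :: real
      show "\<bar>\<phi> x * exp (- (s * x)) - C * ?m1 x\<bar> \<le> \<epsilon> / 2 * ?m1 x + K * ?m0 x"
      proof (cases "0 \<le> x")
        case True
        have "\<phi> x * exp (- (s * x)) - C * ?m1 x = (\<phi> x - C * x) * exp (- (s * x))"
          using True by (simp add: algebra_simps)
        then have "\<bar>\<phi> x * exp (- (s * x)) - C * ?m1 x\<bar> = \<bar>\<phi> x - C * x\<bar> * exp (- (s * x))"
          by (simp only: abs_mult abs_exp_cancel)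
        also have "\<dots> \<le> (\<epsilon> / 2 * x + K) * exp (- (s * x))"
          using bd[OF True] by (intro mult_right_mono) auto
        finally show ?thesis using True by (simp add: algebra_simps)
      next
        case False
        then show ?thesis using bound[of x] by simp
      qed
    qed (use i in \<open>auto intro!: integrable_abs Bochner_Integration.integrable_diff Bochner_Integration.integrable_add integrable_mult_right\<close>)
    also have "\<dots> = \<epsilon> / 2 * (1 / s\<^sup>2) + K * (1 / s)"
      using i v by (subst Bochner_Integration.integral_add) auto
    finally have "s\<^sup>2 * \<bar>laplace \<phi> s - C / s\<^sup>2\<bar> \<le> s\<^sup>2 * (\<epsilon> / 2 * (1 / s\<^sup>2) + K * (1 / s))"
      by (intro mult_left_mono) auto
    moreover have "s\<^sup>2 * \<bar>laplace \<phi> s - C / s\<^sup>2\<bar> = \<bar>s\<^sup>2 * laplace \<phi> s - C\<bar>"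
    proof -
      have "s\<^sup>2 * laplace \<phi> s - C = s\<^sup>2 * (laplace \<phi> s - C / s\<^sup>2)"
        using s by (simp add: field_simps)
      then show ?thesis by (simp only: abs_mult abs_power2)
    qed
    moreover have "s\<^sup>2 * (\<epsilon> / 2 * (1 / s\<^sup>2) + K * (1 / s)) = \<epsilon> / 2 + K * s"
      using s by (simp add: field_simps power2_eq_square)
    ultimately show ?thesis by (simp add: dist_real_def)
  qed
  have "\<forall>\<^sub>F s in at_right 0. K * s < \<epsilon> / 2"
  proof (rule order_tendstoD(2))
    show "((\<lambda>s. K * s) \<longlongrightarrow> 0) (at_right 0)" by (auto intro!: tendsto_eq_intros)
  qed (use \<epsilon> in simp)
  moreover have "\<forall>\<^sub>F s::real in at_right 0. 0 < s"
    by (simp add: eventually_at_right_less)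
  ultimately show "\<forall>\<^sub>F s in at_right 0. dist (s\<^sup>2 * laplace \<phi> s) C < \<epsilon>"
  proof eventually_elim
    case (elim s)
    with main[of s] show ?case by linarith
  qed
qed

end

section \<open>Existence of the limit\<close>

lemma increasing_bounded_tendsto_at_top:
  fixes v :: "real \<Rightarrow> real"
  assumes inc: "\<And>x y. a \<le> x \<Longrightarrow> x \<le> y \<Longrightarrow> v x \<le> v y" and bd: "\<And>x. a \<le> x \<Longrightarrow> v x \<le> B"
  shows "\<exists>V. (v \<longlongrightarrow> V) at_top"
proof
  have bdd: "bdd_above (v ` {a..})" using bd by (intro bdd_aboveI2[where M = B]) auto
  show "(v \<longlongrightarrow> Sup (v ` {a..})) at_top"
  proof (rule order_tendstoI)
    fix y assume "y < Sup (v ` {a..})"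
    then obtain x0 where x0: "a \<le> x0" "y < v x0"
      using less_cSup_iff[OF _ bdd, of y] by auto
    show "\<forall>\<^sub>F x in at_top. y < v x"
      using eventually_ge_at_top[of x0]
      by eventually_elim (use x0 inc in \<open>force intro: less_le_trans\<close>)
  next
    fix y assume y: "Sup (v ` {a..}) < y"
    show "\<forall>\<^sub>F x in at_top. v x < y"
      using eventually_ge_at_top[of a]
    proof eventually_elim
      case (elim x)
      then have "v x \<le> Sup (v ` {a..})" by (intro cSup_upper bdd) auto
      then show ?case using y by linarith
    qed
  qed
qed

context multidisperse
begin

abbreviation "mlen \<equiv> mean_length n len q"

lemma mean_length_bounds: "1 \<le> mlen" "mlen \<le> len n"
proof -
  have "(\<Sum>i=1..n. q i * 1) \<le> mlen"
    unfolding mean_length_def using q_pos len_ge_1 by (intro sum_mono mult_left_mono) (auto simp: less_imp_le)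
  then show "1 \<le> mlen" by (simp add: sum_q del: One_nat_def)
  have "mlen \<le> (\<Sum>i=1..n. q i * len n)"
    unfolding mean_length_def using q_pos len_le_len_n
    by (intro sum_mono mult_left_mono) (auto simp: less_imp_le)
  then show "mlen \<le> len n" by (simp add: sum_q flip: sum_distrib_right del: One_nat_def)
qed

lemma q_k_bounds: "0 \<le> q k" "q k \<le> 1"
proof -
  show "0 \<le> q k" using q_pos[OF k_in] by simp
  have "q k \<le> (\<Sum>i=1..n. q i)"
    using k_in q_pos by (intro member_le_sum) (auto simp: less_imp_le)
  then show "q k \<le> 1" by (simp add: sum_q del: One_nat_def)
qed

definition saturation_primitive :: "real \<Rightarrow> real" where
  "saturation_primitive x = (LBINT b:{0..x}. saturation b)"

lemma set_integrable_saturation: "set_integrable lborel {a..b} saturation"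
proof (rule set_integrable_bounded_Icc)
  show "\<bar>saturation x\<bar> \<le> max 0 b" if "x \<in> {a..b}" for x
    using saturation_bounds[of x] that by auto
qed simp

lemma saturation_integrable_on: "saturation integrable_on {a..b}"
  using set_borel_integral_eq_integral(1)[OF set_integrable_saturation] .

lemma saturation_primitive_eq_integral: "saturation_primitive x = integral {0..x} saturation"
  unfolding saturation_primitive_def
  by (rule set_borel_integral_eq_integral(2)[OF set_integrable_saturation])

lemma saturation_primitive_diff:
  assumes "0 \<le> x" "x \<le> y"
  shows "saturation_primitive y = saturation_primitive x + integral {x..y} saturation"
  unfolding saturation_primitive_eq_integral
  using Henstock_Kurzweil_Integration.integral_combine[OF assms saturation_integrable_on] by simp

lemma saturation_primitive_diff_bounds:
  assumes "0 \<le> x" "x \<le> y"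
  shows "0 \<le> saturation_primitive y - saturation_primitive x"
    "saturation_primitive y - saturation_primitive x \<le> (y - x) * y"
proof -
  have "integral {x..y} saturation \<le> integral {x..y} (\<lambda>_. y)"
    using saturation_bounds(2) assms
    by (intro integral_le saturation_integrable_on) (force intro: order_trans)+
  then show "saturation_primitive y - saturation_primitive x \<le> (y - x) * y"
    using saturation_primitive_diff[OF assms] assms by simp
  have "0 \<le> integral {x..y} saturation"
    using saturation_bounds(1) by (intro Henstock_Kurzweil_Integration.integral_nonneg saturation_integrable_on) auto
  then show "0 \<le> saturation_primitive y - saturation_primitive x"
    using saturation_primitive_diff[OF assms] by simp
qed

lemma saturation_primitive_bounds:
  assumes "0 \<le> x"
  shows "0 \<le> saturation_primitive x" "saturation_primitive x \<le> x\<^sup>2"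
proof -
  have "saturation_primitive 0 = 0" by (simp add: saturation_primitive_eq_integral)
  then show "0 \<le> saturation_primitive x" "saturation_primitive x \<le> x\<^sup>2"
    using saturation_primitive_diff_bounds[of 0 x] assms by (auto simp: power2_eq_square)
qed

text \<open>From \<open>len n\<close> on every type fits, so all truncations disappear and the
  coefficient is linear in \<open>x\<close>. This is why the transform is cut at
  \<open>len n\<close>.\<close>

lemma saturation_rec_ge:
  assumes "len n \<le> x"
  shows "(x - mlen) * saturation x =
    q k * (x - len k) + 2 * (\<Sum>i=1..n. q i * saturation_primitive (x - len i))"
proof -
  have "(\<Sum>i=1..n. q i * max 0 (x - len i)) = (\<Sum>i=1..n. q i * x - q i * len i)"
    using assms len_le_len_n by (intro sum.cong) (force simp: algebra_simps max_def)+
  also have "\<dots> = x - mlen"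
    by (simp add: sum_subtractf sum_q mean_length_def flip: sum_distrib_right del: One_nat_def)
  finally show ?thesis
    using saturation_rec[of x] assms len_le_len_n[OF k_in] len_ge_1[OF k_in]
    by (simp add: saturation_primitive_def del: One_nat_def)
qed

lemma continuous_on_saturation_primitive: "continuous_on {0..b} saturation_primitive"
  using indefinite_integral_continuous_1[OF saturation_integrable_on, of 0 b]
  by (simp add: saturation_primitive_eq_integral[abs_def])

text \<open>The recursion expresses the saturation through its primitive, which is continuous.
  Starting at \<open>len n + 1\<close> keeps the divisor \<open>x - mlen\<close> positive; for
  \<open>n = 1\<close> it vanishes at \<open>len n\<close>, where the saturation jumps from 0 to
  1.\<close>

lemma continuous_on_saturation:
  "continuous_on {len n + 1..b} saturation"
proof -
  have pos: "0 < x - mlen" if "x \<in> {len n + 1..b}" for x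
    using that mean_length_bounds by auto
  have "continuous_on {len n + 1..b} (\<lambda>x. saturation_primitive (x - len i))" if "i \<in> {1..n}" for i
    using len_le_len_n[OF that] len_ge_1[OF that]
    by (intro continuous_on_compose2[OF continuous_on_saturation_primitive[of b]] continuous_intros) auto
  then have "continuous_on {len n + 1..b}
      (\<lambda>x. (q k * (x - len k) + 2 * (\<Sum>i=1..n. q i * saturation_primitive (x - len i))) / (x - mlen))"
    using pos by (intro continuous_intros) force+
  moreover have "saturation x =
      (q k * (x - len k) + 2 * (\<Sum>i=1..n. q i * saturation_primitive (x - len i))) / (x - mlen)"
    if "x \<in> {len n + 1..b}" for x
    using saturation_rec_ge[of x] pos[OF that] that by (simp add: field_simps del: One_nat_def)
  ultimately show ?thesis by (subst continuous_on_cong[OF refl])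
qed

lemma saturation_primitive_has_real_derivative:
  assumes "len n + 1 < x"
  shows "(saturation_primitive has_real_derivative saturation x) (at x)"
proof -
  have l: "1 \<le> len n" using mean_length_bounds by linarith
  have "((\<lambda>x. integral {len n + 1..x} saturation) has_real_derivative saturation x) (at x within {len n + 1..x + 1})"
    using assms by (intro integral_has_real_derivative continuous_on_saturation) auto
  then have "((\<lambda>x. integral {len n + 1..x} saturation) has_real_derivative saturation x) (at x within {len n + 1<..<x + 1})"
    by (rule DERIV_subset) auto
  then have "((\<lambda>x. integral {len n + 1..x} saturation) has_real_derivative saturation x) (at x)"
    using assms by (simp add: at_within_open[of x "{len n + 1<..<x + 1}"])
  then have "((\<lambda>x. saturation_primitive (len n + 1) + integral {len n + 1..x} saturation) has_real_derivative saturation x) (at x)"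
    by (auto intro!: derivative_eq_intros)
  then show ?thesis
  proof (rule has_field_derivative_transform_within_open[where S = "{len n + 1<..}"])
    show "saturation_primitive (len n + 1) + integral {len n + 1..y} saturation = saturation_primitive y"
      if "y \<in> {len n + 1<..}" for y
      using saturation_primitive_diff[of "len n + 1" y] that l by simp
  qed (use assms in auto)
qed

text \<open>In the constant, 1 pays for the term with \<open>q k\<close>, \<open>2 * len n\<close>
  for replacing every shifted primitive by the one at \<open>x\<close> (the saturation is at most
  \<open>x\<close> there), and \<open>len n\<close> for the term
  \<open>mlen * saturation x\<close>.\<close>

lemma saturation_near_double_mean:
  assumes "len n \<le> x"
  shows "\<bar>x * saturation x - 2 * saturation_primitive x\<bar> \<le> (1 + 3 * len n) * x"
proof -
  let ?S = saturation_primitive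
  have l: "1 \<le> len n" using mean_length_bounds by linarith
  have x: "0 \<le> x" "1 \<le> x" using assms l by auto
  have "\<bar>?S (x - len i) - ?S x\<bar> \<le> len n * x" if "i \<in> {1..n}" for i
  proof -
    have "len i * x \<le> len n * x" using len_le_len_n[OF that] x by (intro mult_right_mono) auto
    moreover have "0 \<le> ?S x - ?S (x - len i)" "?S x - ?S (x - len i) \<le> len i * x"
      using saturation_primitive_diff_bounds[of "x - len i" x] len_ge_1[OF that] len_le_len_n[OF that] assms
      by auto
    ultimately show ?thesis by linarith
  qed
  then have "(\<Sum>i=1..n. \<bar>q i * (?S (x - len i) - ?S x)\<bar>) \<le> (\<Sum>i=1..n. q i * (len n * x))"
    using q_pos by (intro sum_mono) (simp add: abs_mult less_imp_le mult_left_mono)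
  also have "\<dots> = len n * x" by (simp add: sum_q flip: sum_distrib_right del: One_nat_def)
  finally have "\<bar>\<Sum>i=1..n. q i * (?S (x - len i) - ?S x)\<bar> \<le> len n * x"
    by (rule order_trans[OF sum_abs])
  moreover have "(\<Sum>i=1..n. q i * (?S (x - len i) - ?S x)) = (\<Sum>i=1..n. q i * ?S (x - len i)) - ?S x"
    by (simp add: right_diff_distrib sum_subtractf sum_q flip: sum_distrib_right del: One_nat_def)
  moreover have "\<bar>q k * (x - len k)\<bar> \<le> x"
    using mult_mono[of "q k" 1 "\<bar>x - len k\<bar>" x] q_k_bounds assms len_le_len_n[OF k_in] len_ge_1[OF k_in] x
    by (auto simp: abs_mult)
  moreover have "\<bar>mlen * saturation x\<bar> \<le> len n * x"
    using mult_mono[of mlen "len n" "saturation x" x] mean_length_bounds saturation_bounds[of x] x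
    by (auto simp: abs_mult)
  moreover have "x * saturation x = q k * (x - len k) + 2 * (\<Sum>i=1..n. q i * ?S (x - len i)) + mlen * saturation x"
    using saturation_rec_ge[OF assms] by (simp add: algebra_simps)
  moreover have "(1 + 3 * len n) * x = x + 3 * (len n * x)" by (simp add: algebra_simps)
  ultimately show ?thesis by linarith
qed

text \<open>The recursion makes the derivative of \<open>saturation_primitive x / x\<^sup>2\<close> of order \<open>1 / x\<^sup>2\<close>, hence
  integrable at infinity.\<close>

lemma saturation_density_exists: "\<exists>C. ((\<lambda>x. saturation x / x) \<longlongrightarrow> C) at_top"
proof -
  define K where "K = 1 + 3 * len n"
  \<comment> \<open>The term \<open>- K / x\<close> has derivative \<open>K / x\<^sup>2\<close>,
    just enough to offset any decrease of \<open>saturation_primitive x / x\<^sup>2\<close>. So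
    \<open>v\<close> is increasing and bounded, with the same limit as that quotient.\<close>
  define v where "v = (\<lambda>x. saturation_primitive x / x\<^sup>2 - K / x)"
  have l: "1 \<le> len n" using mean_length_bounds by linarith
  have v_mono: "v x \<le> v y" if "len n + 2 \<le> x" "x \<le> y" for x y
  proof (rule DERIV_nonneg_imp_nondecreasing[OF that(2)])
    fix z assume "x \<le> z" "z \<le> y"
    then have z: "len n + 1 < z" "0 < z" using that l by auto
    have "(v has_real_derivative (saturation z * z\<^sup>2 - saturation_primitive z * (2 * z)) / (z\<^sup>2 * z\<^sup>2) + K / z\<^sup>2) (at z)"
      unfolding v_def using z
      by (auto intro!: derivative_eq_intros saturation_primitive_has_real_derivative simp: power2_eq_square)
    moreover have "(saturation z * z\<^sup>2 - saturation_primitive z * (2 * z)) / (z\<^sup>2 * z\<^sup>2) + K / z\<^sup>2 =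
        (z * saturation z - 2 * saturation_primitive z + K * z) / (z * z\<^sup>2)"
      using z by (simp add: field_simps power2_eq_square)
    moreover have "0 \<le> \<dots>"
      using saturation_near_double_mean[of z] z by (intro divide_nonneg_nonneg) (auto simp: K_def)
    ultimately show "\<exists>w. (v has_real_derivative w) (at z) \<and> 0 \<le> w" by metis
  qed
  have v_bd: "v x \<le> 1" if "len n + 2 \<le> x" for x
  proof -
    have "saturation_primitive x / x\<^sup>2 \<le> 1"
      using saturation_primitive_bounds[of x] that l by (simp add: divide_le_eq)
    moreover have "0 \<le> K / x" using that l by (simp add: K_def)
    ultimately show ?thesis by (simp add: v_def)
  qed
  obtain V where V: "(v \<longlongrightarrow> V) at_top"
    using increasing_bounded_tendsto_at_top[of "len n + 2" v 1] v_mono v_bd by blast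
  have K0: "((\<lambda>x. K / x) \<longlongrightarrow> 0) at_top"
    by (intro tendsto_divide_0[OF tendsto_const] filterlim_at_top_imp_at_infinity filterlim_ident)
  \<comment> \<open>Here \<open>v x + K / x\<close> is
    \<open>saturation_primitive x / x\<^sup>2\<close>, so the density is twice the limit of
    \<open>v\<close>.\<close>
  have "((\<lambda>x. saturation x / x - 2 * (v x + K / x)) \<longlongrightarrow> 0) at_top"
  proof (rule Lim_null_comparison[OF _ K0])
    show "\<forall>\<^sub>F x in at_top. norm (saturation x / x - 2 * (v x + K / x)) \<le> K / x"
      using eventually_ge_at_top[of "len n"]
    proof eventually_elim
      case (elim x)
      then have x: "0 < x" using l by linarith
      have "saturation x / x - 2 * (v x + K / x) = (x * saturation x - 2 * saturation_primitive x) / x\<^sup>2"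
        using x by (simp add: v_def field_simps power2_eq_square)
      then have "norm (saturation x / x - 2 * (v x + K / x)) = \<bar>x * saturation x - 2 * saturation_primitive x\<bar> / x\<^sup>2"
        by simp
      also have "\<dots> \<le> K * x / x\<^sup>2"
        using saturation_near_double_mean[OF elim] by (intro divide_right_mono) (auto simp: K_def)
      finally show ?case using x by (simp add: power2_eq_square)
    qed
  qed
  then have "((\<lambda>x. (saturation x / x - 2 * (v x + K / x)) + 2 * (v x + K / x)) \<longlongrightarrow> 0 + 2 * (V + 0)) at_top"
    by (intro tendsto_add tendsto_mult tendsto_const V K0)
  then show ?thesis by auto
qed

end

section \<open>The differential equation for the Laplace transform\<close>

context multidisperse
begin

abbreviation "sat_on A \<equiv> (\<lambda>x. indicator A x * saturation x)"

lemma linear_growth_sat_on: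
  assumes "A \<in> sets borel"
  shows "linear_growth (sat_on A)"
proof
  show "\<bar>sat_on A x\<bar> \<le> indicator {0..} x * x" for x
    using saturation_bounds[of x] by (auto simp: indicator_def)
qed (use assms in measurable)

text \<open>The end points are dropped because the expected saturation is junk at \<open>0\<close>, which is an end
  point for \<open>i = n\<close>, and because \<open>len n\<close> is counted in \<open>sat_on {len n..}\<close>.\<close>

lemma P_fun_eq_laplace:
  assumes "i \<in> {1..n}"
  shows "P_fun n len q i k s = laplace (sat_on {len n - len i<..<len n}) s"
  unfolding P_fun_def laplace_def set_lebesgue_integral_def
proof (rule integral_discrete_difference[where X = "{len n - len i, len n}"])
  fix x assume "x \<notin> {len n - len i, len n}"
  then show "indicat_real {len n - len i..len n} x *\<^sub>R (expected_saturation n len q k x * exp (- s * x)) =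
      indicat_real {len n - len i<..<len n} x * saturation x * exp (- (s * x))"
    using len_le_len_n[OF assms] by (auto simp: indicator_def saturation_def)
qed auto

text \<open>Tonelli: after the exchange, the mass at \<open>y\<close> is multiplied by an
  exponential tail. Masses up to \<open>len n - len i\<close> give the boundary term, those between
  \<open>len n - len i\<close> and \<open>len n\<close> give the integral of \<open>P_fun\<close>,
  and those from \<open>len n\<close> on reproduce the tail transform.\<close>

lemma has_bochner_integral_primitive_exp:
  assumes s: "0 < s" and i: "i \<in> {1..n}"
  shows "has_bochner_integral lborel (\<lambda>x. indicator {len n..} x * (saturation_primitive (x - len i) * exp (- (s * x))))
    ((exp (- (s * len n)) * saturation_primitive (len n - len i)
      + exp (- (s * len i)) * (laplace (sat_on {len n - len i<..<len n}) s + laplace (sat_on {len n..}) s)) / s)"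
    (is "has_bochner_integral _ ?f (?R / s)")
proof (rule has_bochner_integral_nn_integral)
  \<comment> \<open>For nonnegative \<open>y\<close>, the least \<open>x\<close> with
    \<open>len n \<le> x\<close> and \<open>y \<le> x - len i\<close>, hence the start of the inner
    integral after the exchange.\<close>
  let ?c = "\<lambda>y. max (len n) (y + len i)"
  have l: "len i \<le> len n" "1 \<le> len i" using len_le_len_n[OF i] len_ge_1[OF i] by auto
  interpret A: linear_growth "sat_on {len n - len i<..<len n}" by (rule linear_growth_sat_on) simp
  interpret B: linear_growth "sat_on {len n..}" by (rule linear_growth_sat_on) simp
  have iA: "integrable lborel (\<lambda>y. sat_on {len n - len i<..<len n} y * exp (- (s * y)))"
    using A.integrable_moment[OF s, of 0] by simp
  have iB: "integrable lborel (\<lambda>y. sat_on {len n..} y * exp (- (s * y)))"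
    using B.integrable_moment[OF s, of 0] by simp
  have iC: "integrable lborel (\<lambda>y. sat_on {0..len n - len i} y)"
    using set_integrable_saturation[of 0 "len n - len i"] by (simp add: set_integrable_def)
  have S_meas [measurable]: "saturation_primitive \<in> borel_measurable borel"
  proof (intro borel_measurable_mono monoI)
    fix x y :: real assume "x \<le> y"
    then show "saturation_primitive x \<le> saturation_primitive y"
      using saturation_primitive_diff_bounds[of x y] saturation_primitive_bounds[of y]
      by (cases "0 \<le> x"; cases "0 \<le> y") (auto simp: saturation_primitive_def set_lebesgue_integral_def)
  qed
  have split: "saturation y * exp (- (s * ?c y)) =
      exp (- (s * len n)) * sat_on {0..len n - len i} y
      + exp (- (s * len i)) * (sat_on {len n - len i<..<len n} y * exp (- (s * y)) + sat_on {len n..} y * exp (- (s * y)))"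
    for y
  proof (cases "y < 0")
    case True
    then show ?thesis using saturation_bounds[of y] l by (simp add: indicator_def)
  next
    case False
    have "exp (- (s * (y + len i))) = exp (- (s * len i)) * exp (- (s * y))"
      unfolding exp_add[symmetric] by (rule arg_cong[where f = exp]) (simp add: algebra_simps)
    moreover have "?c y = (if y \<le> len n - len i then len n else y + len i)" by auto
    ultimately show ?thesis using False l by (auto simp: indicator_def)
  qed
  have int_split: "integrable lborel (\<lambda>y. saturation y * exp (- (s * ?c y)))"
    unfolding split using iA iB iC by (intro Bochner_Integration.integrable_add integrable_mult_right) auto
  have val_split: "(\<integral>y. saturation y * exp (- (s * ?c y)) \<partial>lborel) = ?R"
    unfolding split using iA iB iC
    by (simp add: laplace_def saturation_primitive_def set_lebesgue_integral_def)
  have inner: "ennreal (saturation_primitive y) = (\<integral>\<^sup>+b. ennreal (indicator {0..y} b * saturation b) \<partial>lborel)" for y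
    unfolding saturation_primitive_def set_lebesgue_integral_def
    using set_integrable_saturation[of 0 y] saturation_bounds
    by (subst nn_integral_eq_integral) (auto simp: set_integrable_def)
  have tail: "(\<integral>\<^sup>+x. ennreal (indicator {c..} x * exp (- (s * x))) \<partial>lborel) = ennreal (exp (- (s * c)) / s)" for c
    using has_bochner_integral_power_exp_shift[OF s, of c 0]
    by (subst nn_integral_eq_integral) (auto simp: has_bochner_integral_iff)
  have "(\<integral>\<^sup>+x. ennreal (?f x) \<partial>lborel) =
      (\<integral>\<^sup>+x. (\<integral>\<^sup>+y. ennreal (indicator {len n..} x * exp (- (s * x)) * (indicator {0..x - len i} y * saturation y)) \<partial>lborel) \<partial>lborel)"
  proof (rule nn_integral_cong)
    fix x :: real
    have "ennreal (?f x) = ennreal (indicator {len n..} x * exp (- (s * x))) * ennreal (saturation_primitive (x - len i))"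
      by (subst ennreal_mult'[symmetric]) (auto simp: mult_ac)
    then show "ennreal (?f x) =
        (\<integral>\<^sup>+y. ennreal (indicator {len n..} x * exp (- (s * x)) * (indicator {0..x - len i} y * saturation y)) \<partial>lborel)"
      unfolding inner by (simp add: nn_integral_cmult[symmetric] ennreal_mult')
  qed
  also have "\<dots> = (\<integral>\<^sup>+y. (\<integral>\<^sup>+x. ennreal (indicator {len n..} x * exp (- (s * x)) * (indicator {0..x - len i} y * saturation y)) \<partial>lborel) \<partial>lborel)"
  proof (rule lborel_pair.Fubini'[symmetric])
    have [measurable]: "Measurable.pred (borel \<Otimes>\<^sub>M borel) (\<lambda>p :: real \<times> real. snd p \<in> {0..fst p - len i})"
      unfolding atLeastAtMost_iff by measurable
    show "(\<lambda>(x, y). ennreal (indicator {len n..} x * exp (- (s * x)) * (indicator {0..x - len i} y * saturation y)))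
        \<in> borel_measurable (lborel \<Otimes>\<^sub>M lborel)"
      unfolding case_prod_beta' by measurable
  qed
  also have "\<dots> = (\<integral>\<^sup>+y. ennreal (saturation y * exp (- (s * ?c y)) / s) \<partial>lborel)"
  proof (rule nn_integral_cong)
    fix y :: real
    have "(\<integral>\<^sup>+x. ennreal (indicator {len n..} x * exp (- (s * x)) * (indicator {0..x - len i} y * saturation y)) \<partial>lborel) =
        (\<integral>\<^sup>+x. ennreal (saturation y) * ennreal (indicator {?c y..} x * exp (- (s * x))) \<partial>lborel)"
    proof (rule nn_integral_cong)
      fix x :: real
      have "indicator {len n..} x * exp (- (s * x)) * (indicator {0..x - len i} y * saturation y) =
          saturation y * (indicator {?c y..} x * exp (- (s * x)))"
        using saturation_bounds[of y] by (cases "0 \<le> y") (auto simp: indicator_def)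
      then show "ennreal (indicator {len n..} x * exp (- (s * x)) * (indicator {0..x - len i} y * saturation y)) =
          ennreal (saturation y) * ennreal (indicator {?c y..} x * exp (- (s * x)))"
        by (simp only: ennreal_mult'[OF saturation_bounds(1)])
    qed
    also have "\<dots> = ennreal (saturation y) * ennreal (exp (- (s * ?c y)) / s)"
      by (simp add: nn_integral_cmult tail)
    finally show "(\<integral>\<^sup>+x. ennreal (indicator {len n..} x * exp (- (s * x)) * (indicator {0..x - len i} y * saturation y)) \<partial>lborel) =
        ennreal (saturation y * exp (- (s * ?c y)) / s)"
      using saturation_bounds by (simp add: ennreal_mult'[symmetric])
  qed
  also have "\<dots> = ennreal (\<integral>y. saturation y * exp (- (s * ?c y)) / s \<partial>lborel)"
    using int_split saturation_bounds s by (intro nn_integral_eq_integral AE_I2) auto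
  finally show "(\<integral>\<^sup>+x. ennreal (?f x) \<partial>lborel) = ennreal (?R / s)"
    by (simp add: val_split)
  have "0 \<le> (\<integral>y. saturation y * exp (- (s * ?c y)) \<partial>lborel)"
    using saturation_bounds by (intro integral_nonneg_AE) auto
  then show "0 \<le> ?R / s" unfolding val_split using s by simp
  show "AE x in lborel. 0 \<le> ?f x"
    using l saturation_primitive_bounds by (auto simp: indicator_def)
  show "?f \<in> borel_measurable lborel" by measurable
qed

abbreviation "tail_transform \<equiv> laplace (sat_on {len n..})"

text \<open>The inhomogeneous part of the differential equation: what remains of the transformed
  recursion once the multiples of \<open>tail_transform\<close> are removed.\<close>

definition source_term :: "real \<Rightarrow> real" where
  "source_term s = exp (- (s * len n)) * ((len n - mlen) * saturation (len n) / s + q k / s\<^sup>2)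
     + 2 / s * (\<Sum>i=1..n. q i * exp (- (s * len i)) * laplace (sat_on {len n - len i<..<len n}) s)"

text \<open>Multiply the recursion by \<open>exp (- (s * x))\<close> and integrate from
  \<open>len n\<close>: the factor \<open>x\<close> on its left side turns into minus the derivative
  of the transform.\<close>

lemma tail_transform_has_real_derivative:
  assumes s: "0 < s"
  shows "(tail_transform has_real_derivative
    - (mlen * tail_transform s + source_term s
       + 2 / s * (\<Sum>i=1..n. q i * exp (- (s * len i))) * tail_transform s)) (at s)"
proof -
  interpret linear_growth "sat_on {len n..}" by (rule linear_growth_sat_on) simp
  let ?\<phi> = "sat_on {len n..}"
  let ?P = "\<lambda>i. laplace (sat_on {len n - len i<..<len n}) s"
  let ?e = "exp (- (s * len n))"
  note m0 = has_bochner_integral_power_exp_shift[OF s, of "len n" 0]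
    and m1 = has_bochner_integral_power_exp_shift[OF s, of "len n" 1]
  have i0: "integrable lborel (\<lambda>x. ?\<phi> x * exp (- (s * x)))"
    using integrable_moment[OF s, of 0] by simp
  have i1: "integrable lborel (\<lambda>x. x * (?\<phi> x * exp (- (s * x))))"
    using integrable_moment[OF s, of 1] by simp
  have pos: "0 < q i" if "i \<in> {1..n}" for i using q_pos[OF that] .
  let ?V = "\<lambda>i. (?e * saturation_primitive (len n - len i) + exp (- (s * len i)) * (?P i + tail_transform s)) / s"
  have b1: "has_bochner_integral lborel
      (\<lambda>x. q k * (indicator {len n..} x * ((x - len n) ^ 1 * exp (- (s * x))))
        + q k * (len n - len k) * (indicator {len n..} x * ((x - len n) ^ 0 * exp (- (s * x)))))
      (q k * (?e * (fact 1 / s ^ Suc 1)) + q k * (len n - len k) * (?e * (fact 0 / s ^ Suc 0)))"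
    using m0 m1 by (intro has_bochner_integral_add has_bochner_integral_mult_right) auto
  have b2: "has_bochner_integral lborel
      (\<lambda>x. 2 * (\<Sum>i=1..n. q i * (indicator {len n..} x * (saturation_primitive (x - len i) * exp (- (s * x))))))
      (2 * (\<Sum>i=1..n. q i * ?V i))"
    using has_bochner_integral_primitive_exp[OF s]
    by (intro has_bochner_integral_mult_right has_bochner_integral_sum) auto
  have eq: "q k * (indicator {len n..} x * ((x - len n) ^ 1 * exp (- (s * x))))
        + q k * (len n - len k) * (indicator {len n..} x * ((x - len n) ^ 0 * exp (- (s * x))))
        + 2 * (\<Sum>i=1..n. q i * (indicator {len n..} x * (saturation_primitive (x - len i) * exp (- (s * x))))) =
      x * (?\<phi> x * exp (- (s * x))) - mlen * (?\<phi> x * exp (- (s * x)))" for x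
  proof (cases "len n \<le> x")
    case True
    have "x * (?\<phi> x * exp (- (s * x))) - mlen * (?\<phi> x * exp (- (s * x))) = (x - mlen) * saturation x * exp (- (s * x))"
      using True by (simp add: algebra_simps)
    also have "\<dots> = (q k * (x - len k) + 2 * (\<Sum>i=1..n. q i * saturation_primitive (x - len i))) * exp (- (s * x))"
      using saturation_rec_ge[OF True] by simp
    finally show ?thesis
      using True by (simp add: algebra_simps sum_distrib_left sum_distrib_right)
  qed simp
  have "(\<integral>x. x * (?\<phi> x * exp (- (s * x))) \<partial>lborel) - mlen * tail_transform s =
      (\<integral>x. x * (?\<phi> x * exp (- (s * x))) - mlen * (?\<phi> x * exp (- (s * x))) \<partial>lborel)"
    unfolding laplace_def using i0 i1 by simp
  also have "\<dots> = q k * (?e * (fact 1 / s ^ Suc 1)) + q k * (len n - len k) * (?e * (fact 0 / s ^ Suc 0))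
      + 2 * (\<Sum>i=1..n. q i * ?V i)"
    using has_bochner_integral_integral_eq[OF has_bochner_integral_add[OF b1 b2]] unfolding eq .
  also have "(\<Sum>i=1..n. q i * ?V i) =
      ?e / s * (\<Sum>i=1..n. q i * saturation_primitive (len n - len i))
      + 1 / s * (\<Sum>i=1..n. q i * exp (- (s * len i)) * ?P i)
      + 1 / s * (\<Sum>i=1..n. q i * exp (- (s * len i))) * tail_transform s"
    unfolding sum_distrib_left sum_distrib_right sum.distrib[symmetric]
    using s by (intro sum.cong) (auto simp: field_simps)
  also have "q k * (?e * (fact 1 / s ^ Suc 1)) + q k * (len n - len k) * (?e * (fact 0 / s ^ Suc 0))
      + 2 * (?e / s * (\<Sum>i=1..n. q i * saturation_primitive (len n - len i))
      + 1 / s * (\<Sum>i=1..n. q i * exp (- (s * len i)) * ?P i)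
      + 1 / s * (\<Sum>i=1..n. q i * exp (- (s * len i))) * tail_transform s) =
      ?e * ((q k * (len n - len k) + 2 * (\<Sum>i=1..n. q i * saturation_primitive (len n - len i))) / s + q k / s\<^sup>2)
      + 2 / s * (\<Sum>i=1..n. q i * exp (- (s * len i)) * ?P i)
      + 2 / s * (\<Sum>i=1..n. q i * exp (- (s * len i))) * tail_transform s"
    using s by (simp add: field_simps power2_eq_square)
  \<comment> \<open>The bracket divided by \<open>s\<close> is the right side of the recursion at
    \<open>x = len n\<close>; reading it backwards turns all boundary values of the primitive into
    \<open>(len n - mlen) * saturation (len n)\<close>.\<close>
  also have "\<dots> = source_term s + 2 / s * (\<Sum>i=1..n. q i * exp (- (s * len i))) * tail_transform s"
    unfolding saturation_rec_ge[OF order_refl, symmetric] source_term_def by simp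
  finally have D: "(\<integral>x. x * (?\<phi> x * exp (- (s * x))) \<partial>lborel) =
      mlen * tail_transform s + source_term s
       + 2 / s * (\<Sum>i=1..n. q i * exp (- (s * len i))) * tail_transform s" by simp
  show ?thesis
    using laplace_has_real_derivative[OF s] unfolding D .
qed

lemma Ein_sum_has_real_derivative:
  assumes "0 < s"
  shows "((\<lambda>s. \<Sum>i=1..n. q i * Ein (len i * s)) has_real_derivative
    (1 - (\<Sum>i=1..n. q i * exp (- (s * len i)))) / s) (at s)"
proof -
  have "((\<lambda>s. Ein (len i * s)) has_real_derivative (1 - exp (- (s * len i))) / s) (at s)" if "i \<in> {1..n}" for i
    using len_ge_1[OF that] assms
      DERIV_chain2[OF Ein_has_real_derivative[of "len i * s"] DERIV_cmult_Id[of "len i"]]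
    by (simp add: mult.commute)
  then have "((\<lambda>s. \<Sum>i=1..n. q i * Ein (len i * s)) has_real_derivative
      (\<Sum>i=1..n. q i * ((1 - exp (- (s * len i))) / s))) (at s)"
    by (intro DERIV_sum DERIV_cmult)
  also have "(\<Sum>i=1..n. q i * ((1 - exp (- (s * len i))) / s)) =
      ((\<Sum>i=1..n. q i) - (\<Sum>i=1..n. q i * exp (- (s * len i)))) / s"
    by (simp add: sum_divide_distrib right_diff_distrib diff_divide_distrib flip: sum_subtractf)
  finally show ?thesis by (simp only: sum_q)
qed

lemma G_fun_eq_source_term:
  assumes s: "0 < s"
  shows "G_fun n len q k s = s\<^sup>2 * exp (mlen * s) * source_term s"
proof -
  let ?P = "\<Sum>i=1..n. q i * exp (- (s * len i)) * laplace (sat_on {len n - len i<..<len n}) s"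
  have P: "(\<Sum>i=1..n. q i * exp (- len i * s) * P_fun n len q i k s) = ?P"
    using P_fun_eq_laplace by (intro sum.cong) (auto simp: mult.commute)
  have l: "expected_saturation n len q k (len n) = saturation (len n)"
    using mean_length_bounds by (simp add: saturation_def)
  have e: "exp (- (len n - mlen) * s) = exp (mlen * s) * exp (- (s * len n))"
    unfolding exp_add[symmetric] by (rule arg_cong[where f = exp]) (simp add: algebra_simps)
  have 1: "s\<^sup>2 * (b / s + c / s\<^sup>2) = c + s * b" "s\<^sup>2 * (2 / s * d) = 2 * s * d" for b c d
    using s by (simp_all add: field_simps power2_eq_square)
  have "s\<^sup>2 * exp (mlen * s) * source_term s =
      exp (mlen * s) * (exp (- (s * len n)) * (s\<^sup>2 * ((len n - mlen) * saturation (len n) / s + q k / s\<^sup>2)) + s\<^sup>2 * (2 / s * ?P))"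
    unfolding source_term_def by (simp only: distrib_left mult_ac)
  then show ?thesis
    unfolding G_fun_def P l e 1 by (simp add: algebra_simps)
qed

lemma laplace_sat_on_nonneg: "0 \<le> laplace (sat_on A) s"
  unfolding laplace_def using saturation_bounds by (intro integral_nonneg_AE) auto

text \<open>The sign allows the fundamental theorem to deliver integrability on the half line along
  with the value of the integral.\<close>

lemma G_fun_nonneg:
  assumes "0 < s"
  shows "0 \<le> G_fun n len q k s"
proof -
  have "0 \<le> (\<Sum>i=1..n. q i * exp (- (s * len i)) * laplace (sat_on {len n - len i<..<len n}) s)"
    using q_pos laplace_sat_on_nonneg by (intro sum_nonneg mult_nonneg_nonneg) (auto simp: less_imp_le)
  then have "0 \<le> source_term s"
    unfolding source_term_def using assms mean_length_bounds saturation_bounds q_k_bounds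
    by (intro add_nonneg_nonneg mult_nonneg_nonneg divide_nonneg_nonneg) auto
  then show ?thesis using G_fun_eq_source_term[OF assms] by simp
qed

lemma isCont_G_fun:
  assumes s: "0 < s"
  shows "isCont (G_fun n len q k) s"
proof -
  have "isCont (P_fun n len q i k) s" if "i \<in> {1..n}" for i
  proof -
    interpret linear_growth "sat_on {len n - len i<..<len n}" by (rule linear_growth_sat_on) simp
    have "isCont (laplace (sat_on {len n - len i<..<len n})) s"
      using laplace_has_real_derivative[OF s] by (rule DERIV_isCont)
    moreover have "P_fun n len q i k = laplace (sat_on {len n - len i<..<len n})"
      using P_fun_eq_laplace[OF that] by (rule ext)
    ultimately show ?thesis by simp
  qed
  then show ?thesis unfolding G_fun_def[abs_def] by (intro continuous_intros)
qed

section \<open>The antiderivative and its boundary values\<close>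

definition transform_primitive :: "real \<Rightarrow> real" where
  "transform_primitive s =
     exp (mlen * s - 2 * (\<Sum>i=1..n. q i * Ein (len i * s))) * (s\<^sup>2 * tail_transform s)"

text \<open>Multiplication by this exponential is the integrating factor of the differential equation
  of \<open>tail_transform\<close>.\<close>

lemma transform_primitive_has_real_derivative:
  assumes s: "0 < s"
  shows "(transform_primitive has_real_derivative
    - (G_fun n len q k s * exp (- 2 * (\<Sum>i=1..n. q i * Ein (len i * s))))) (at s)"
proof -
  define E where "E = (\<lambda>s. \<Sum>i=1..n. q i * Ein (len i * s))"
  define Q where "Q = (\<Sum>i=1..n. q i * exp (- (s * len i)))"
  define F' where "F' = - (mlen * tail_transform s + source_term s + 2 / s * Q * tail_transform s)"
  have E: "(E has_real_derivative (1 - Q) / s) (at s)"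
    unfolding E_def Q_def by (rule Ein_sum_has_real_derivative[OF s])
  have F: "(tail_transform has_real_derivative F') (at s)"
    unfolding F'_def Q_def by (rule tail_transform_has_real_derivative[OF s])
  have "((\<lambda>s. exp (mlen * s - 2 * E s)) has_real_derivative
      exp (mlen * s - 2 * E s) * (mlen - 2 * ((1 - Q) / s))) (at s)"
    by (auto intro!: derivative_eq_intros E)
  moreover have "((\<lambda>s. s\<^sup>2 * tail_transform s) has_real_derivative
      2 * s * tail_transform s + s\<^sup>2 * F') (at s)"
    by (auto intro!: derivative_eq_intros F)
  ultimately have "((\<lambda>s. exp (mlen * s - 2 * E s) * (s\<^sup>2 * tail_transform s)) has_real_derivative
      exp (mlen * s - 2 * E s) * (2 * s * tail_transform s + s\<^sup>2 * F')
      + exp (mlen * s - 2 * E s) * (mlen - 2 * ((1 - Q) / s)) * (s\<^sup>2 * tail_transform s)) (at s)"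
    by (rule DERIV_mult')
  moreover have "exp (mlen * s - 2 * E s) * (2 * s * tail_transform s + s\<^sup>2 * F')
      + exp (mlen * s - 2 * E s) * (mlen - 2 * ((1 - Q) / s)) * (s\<^sup>2 * tail_transform s) =
      exp (mlen * s - 2 * E s) * - (s\<^sup>2 * source_term s)"
  proof -
    \<comment> \<open>Relative to \<open>s\<^sup>2 * tail_transform s\<close>, the square
      contributes \<open>2 / s\<close>, the sum of \<open>Ein\<close> terms
      \<open>- 2 * (1 - Q) / s\<close> and the equation \<open>- 2 * Q / s - mlen\<close>; with
      \<open>mlen\<close> from the exponential everything cancels except the source.\<close>
    have "2 * s * tail_transform s + s\<^sup>2 * F' + (mlen - 2 * ((1 - Q) / s)) * (s\<^sup>2 * tail_transform s) =
        - (s\<^sup>2 * source_term s)"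
      unfolding F'_def using s by (simp add: field_simps power2_eq_square)
    then show ?thesis by (simp only: mult.assoc distrib_left[symmetric])
  qed
  moreover have "exp (mlen * s - 2 * E s) * - (s\<^sup>2 * source_term s) = - (G_fun n len q k s * exp (- 2 * E s))"
  proof -
    have "exp (mlen * s - 2 * E s) = exp (mlen * s) * exp (- 2 * E s)"
      unfolding exp_add[symmetric] by simp
    then show ?thesis unfolding G_fun_eq_source_term[OF s] by (simp add: mult_ac)
  qed
  ultimately show ?thesis
    unfolding transform_primitive_def[abs_def] E_def by simp
qed

text \<open>Cutting off the saturation below \<open>len n\<close> does not affect its density at
  infinity, so the Abelian lemma applies to the tail, while the exponential factor tends to
  1.\<close>

lemma transform_primitive_tendsto_at_right_0:
  assumes "((\<lambda>x. saturation x / x) \<longlongrightarrow> C) at_top"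
  shows "(transform_primitive \<longlongrightarrow> C) (at_right 0)"
proof -
  interpret linear_growth "sat_on {len n..}" by (rule linear_growth_sat_on) simp
  have "((\<lambda>x. sat_on {len n..} x / x) \<longlongrightarrow> C) at_top"
    using assms
  proof (rule Lim_transform_eventually)
    show "\<forall>\<^sub>F x in at_top. saturation x / x = sat_on {len n..} x / x"
      using eventually_ge_at_top[of "len n"] by eventually_elim simp
  qed
  from abelian[OF this] have 1: "((\<lambda>s. s\<^sup>2 * tail_transform s) \<longlongrightarrow> C) (at_right 0)" .
  have "((\<lambda>s. Ein (len i * s)) \<longlongrightarrow> 0) (at_right 0)" if "i \<in> {1..n}" for i
  proof (rule filterlim_compose[OF Ein_tendsto_0])
    have "((\<lambda>s. len i * s) \<longlongrightarrow> len i * 0) (at_right 0)" by (intro tendsto_intros)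
    moreover have "\<forall>\<^sub>F s in at_right 0. 0 < len i * s"
      using len_ge_1[OF that] eventually_at_right_less[of 0] by (auto elim!: eventually_mono)
    ultimately show "filterlim (\<lambda>s. len i * s) (at_right 0) (at_right 0)"
      unfolding filterlim_at by (auto elim!: eventually_mono)
  qed
  then have "((\<lambda>s. exp (mlen * s - 2 * (\<Sum>i=1..n. q i * Ein (len i * s)))) \<longlongrightarrow>
      exp (mlen * 0 - 2 * (\<Sum>i=1..n. q i * 0))) (at_right 0)"
    by (intro tendsto_intros)
  from tendsto_mult[OF this 1] show ?thesis
    by (simp add: transform_primitive_def[abs_def])
qed

text \<open>Two cancellations: the logarithmic growth of \<open>Ein\<close> reduces
  \<open>s\<^sup>2\<close> times the exponential of minus twice the sum to at most
  \<open>exp 2\<close>, and \<open>mlen \<le> len n\<close> lets the decay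
  \<open>exp (- (s * len n))\<close> of the tail absorb \<open>exp (mlen * s)\<close>.\<close>

lemma transform_primitive_bounds:
  assumes s: "1 \<le> s"
  shows "0 \<le> transform_primitive s"
    "transform_primitive s \<le> exp 2 * (len n / s + 1 / s\<^sup>2)"
proof -
  interpret linear_growth "sat_on {len n..}" by (rule linear_growth_sat_on) simp
  have s0: "0 < s" using s by simp
  let ?E = "\<Sum>i=1..n. q i * Ein (len i * s)"
  have "(\<Sum>i=1..n. q i * (ln s - 1)) \<le> ?E"
  proof (intro sum_mono mult_left_mono)
    fix i assume i: "i \<in> {1..n}"
    have "ln s \<le> ln (len i * s)" "1 \<le> len i * s"
      using len_ge_1[OF i] s mult_mono[of 1 "len i" 1 s] by (auto simp: ln_mult)
    then show "ln s - 1 \<le> Ein (len i * s)" using Ein_ge_ln[of "len i * s"] by linarith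
    show "0 \<le> q i" using q_pos[OF i] by simp
  qed
  then have "ln s - 1 \<le> ?E"
    by (simp add: sum_q flip: sum_distrib_right del: One_nat_def)
  then have "exp (- 2 * ?E) \<le> exp (2 - 2 * ln s)" by simp
  also have "\<dots> = exp 2 / s\<^sup>2"
    using s0 by (simp add: exp_diff exp_double)
  finally have E: "s\<^sup>2 * exp (- 2 * ?E) \<le> exp 2"
    using s0 by (simp add: field_simps)
  have b: "has_bochner_integral lborel
      (\<lambda>x. indicator {len n..} x * ((x - len n) ^ 1 * exp (- (s * x)))
         + len n * (indicator {len n..} x * ((x - len n) ^ 0 * exp (- (s * x)))))
      (exp (- (s * len n)) * (fact 1 / s ^ Suc 1) + len n * (exp (- (s * len n)) * (fact 0 / s ^ Suc 0)))"
    by (intro has_bochner_integral_add has_bochner_integral_mult_right has_bochner_integral_power_exp_shift s0)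
  have "tail_transform s \<le> exp (- (s * len n)) * (fact 1 / s ^ Suc 1) + len n * (exp (- (s * len n)) * (fact 0 / s ^ Suc 0))"
    unfolding has_bochner_integral_integral_eq[OF b, symmetric] laplace_def
  proof (rule integral_mono)
    show "integrable lborel (\<lambda>x. sat_on {len n..} x * exp (- (s * x)))"
      using integrable_moment[OF s0, of 0] by simp
    show "sat_on {len n..} x * exp (- (s * x)) \<le> indicator {len n..} x * ((x - len n) ^ 1 * exp (- (s * x)))
         + len n * (indicator {len n..} x * ((x - len n) ^ 0 * exp (- (s * x))))" for x
    proof (cases "len n \<le> x")
      case True
      then have "saturation x \<le> x" using saturation_bounds[of x] mean_length_bounds by auto
      then have "saturation x * exp (- (s * x)) \<le> x * exp (- (s * x))" by (intro mult_right_mono) auto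
      then show ?thesis using True by (simp add: algebra_simps)
    qed simp
  qed (use b in \<open>simp add: has_bochner_integral_iff\<close>)
  also have "\<dots> = exp (- (s * len n)) * (len n / s + 1 / s\<^sup>2)"
    using s0 by (simp add: field_simps power2_eq_square)
  finally have "exp (mlen * s) * tail_transform s \<le> exp (len n * s) * (exp (- (s * len n)) * (len n / s + 1 / s\<^sup>2))"
    using mean_length_bounds s laplace_sat_on_nonneg by (intro mult_mono) auto
  also have "\<dots> = len n / s + 1 / s\<^sup>2"
    by (simp add: mult.commute[of s] flip: mult.assoc exp_add)
  finally have F: "exp (mlen * s) * tail_transform s \<le> len n / s + 1 / s\<^sup>2" .
  have eq: "transform_primitive s = (s\<^sup>2 * exp (- 2 * ?E)) * (exp (mlen * s) * tail_transform s)"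
  proof -
    have "exp (mlen * s - 2 * ?E) = exp (mlen * s) * exp (- 2 * ?E)"
      unfolding exp_add[symmetric] by simp
    then show ?thesis unfolding transform_primitive_def by (simp only: mult_ac)
  qed
  show "0 \<le> transform_primitive s"
    unfolding eq using laplace_sat_on_nonneg by (intro mult_nonneg_nonneg) auto
  show "transform_primitive s \<le> exp 2 * (len n / s + 1 / s\<^sup>2)"
    unfolding eq using E F laplace_sat_on_nonneg by (intro mult_mono) auto
qed

lemma transform_primitive_tendsto_at_top: "(transform_primitive \<longlongrightarrow> 0) at_top"
proof (rule Lim_null_comparison)
  show "\<forall>\<^sub>F s in at_top. norm (transform_primitive s) \<le> exp 2 * (len n / s + 1 / s\<^sup>2)"
    using eventually_ge_at_top[of 1]
    by eventually_elim (use transform_primitive_bounds in simp)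
  have "((\<lambda>s. exp 2 * (len n / s + 1 / s\<^sup>2)) \<longlongrightarrow> exp 2 * (0 + 0)) at_top"
    by (intro tendsto_intros tendsto_divide_0[OF tendsto_const] filterlim_at_top_imp_at_infinity
        filterlim_ident filterlim_pow_at_top) auto
  then show "((\<lambda>s. exp 2 * (len n / s + 1 / s\<^sup>2)) \<longlongrightarrow> 0) at_top" by simp
qed

end

text \<open>Integrability belongs to the claim because the integral of a function that is not
  integrable would be the default value 0.\<close>

theorem theorem4p4:
  fixes n k :: nat and len q :: "nat \<Rightarrow> real"
  assumes "n \<ge> 1"
    and "len 1 = 1"
    and "strict_mono_on {1..n} len"
    and "\<And>i. i \<in> {1..n} \<Longrightarrow> q i > 0"
    and "(\<Sum>i=1..n. q i) = 1"
    and "k \<in> {1..n}"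
  shows "set_integrable lborel {0<..}
           (\<lambda>t. G_fun n len q k t * exp (- 2 * (\<Sum>i=1..n. q i * Ein (len i * t))))
       \<and> ((\<lambda>L. expected_saturation n len q k L / L) \<longlongrightarrow>
           (LBINT t:{0<..}. G_fun n len q k t * exp (- 2 * (\<Sum>i=1..n. q i * Ein (len i * t)))))
           at_top"
proof -
  interpret multidisperse n k len q
    using assms by unfold_locales
  obtain C where C: "((\<lambda>x. saturation x / x) \<longlongrightarrow> C) at_top"
    using saturation_density_exists by blast
  let ?f = "\<lambda>t. G_fun n len q k t * exp (- 2 * (\<Sum>i=1..n. q i * Ein (len i * t)))"
  have ivl: "einterval 0 \<infinity> = {0<..}" by (auto simp: einterval_iff)
  have "((\<lambda>s. - transform_primitive s) has_real_derivative ?f s) (at s)" if "0 < ereal s" for s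
    using DERIV_minus[OF transform_primitive_has_real_derivative[of s]] that by simp
  moreover have "isCont ?f s" if "0 < ereal s" for s
    using that by (intro continuous_mult continuous_exp continuous_const isCont_G_fun
        DERIV_isCont[OF Ein_sum_has_real_derivative]) auto
  moreover have "0 \<le> ?f s" if "0 < ereal s" for s
    using that G_fun_nonneg[of s] by simp
  moreover have "(((\<lambda>s. - transform_primitive s) \<circ> real_of_ereal) \<longlongrightarrow> - C) (at_right 0)"
    using tendsto_minus[OF transform_primitive_tendsto_at_right_0[OF C]]
    by (simp add: ereal_tendsto_simps zero_ereal_def)
  moreover have "(((\<lambda>s. - transform_primitive s) \<circ> real_of_ereal) \<longlongrightarrow> 0) (at_left \<infinity>)"
    using tendsto_minus[OF transform_primitive_tendsto_at_top]
    by (simp add: ereal_tendsto_simps)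
  \<comment> \<open>The nonnegative form of the fundamental theorem, applied to
    \<open>- transform_primitive\<close>: its limits \<open>- C\<close> at 0 and 0 at infinity give
    integrability and the value together.\<close>
  ultimately have "set_integrable lborel (einterval 0 \<infinity>) ?f" "(LBINT t=0..\<infinity>. ?f t) = 0 - - C"
    by (intro interval_integral_FTC_nonneg[where F = "\<lambda>s. - transform_primitive s"] AE_I2; simp)+
  then have f: "set_integrable lborel {0<..} ?f" "(LBINT t:{0<..}. ?f t) = C"
    by (simp_all add: interval_lebesgue_integral_def ivl)
  have "((\<lambda>L. expected_saturation n len q k L / L) \<longlongrightarrow> C) at_top"
    using C
  proof (rule Lim_transform_eventually)
    show "\<forall>\<^sub>F L in at_top. saturation L / L = expected_saturation n len q k L / L"
      using eventually_gt_at_top[of 0] by eventually_elim (simp add: saturation_def)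
  qed
  with f show ?thesis by simp
qed

end
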